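(* Let $\{\mathcal{T}(t)\}_{t\ge 0}$ be the symmetric telegraph process with speed $c>0$ and rate $\lambda>0$, and let $t>0$. Put $M(t)=\max_{0\le s\le t}\mathcal{T}(s)$. For $0<\beta<ct$, $$P\{ M(t) \in d\beta,\ N(t)\text{ even} \mid V(0) = -c\} = e^{-\lambda t}\frac{\lambda(ct-\beta)}{c\sqrt{c^2t^2-\beta^2}}\, I_1\Bigl(\tfrac{\lambda}{c}\sqrt{c^2t^2-\beta^2}\Bigr)d\beta = \frac{e^{-\lambda t}}{c}\Bigl(1-\frac{\beta}{ct}\Bigr)\frac{\partial}{\partial t} I_0\Bigl(\tfrac{\lambda}{c}\sqrt{c^2t^2-\beta^2}\Bigr)d\beta$$ and $$P\{ M(t) \in d\beta,\ N(t)\text{ odd} \mid V(0) = -c\} = \frac{e^{-\lambda t}}{ct+\beta}\Biggl[\lambda t\, I_0\Bigl(\tfrac{\lambda}{c}\sqrt{c^2t^2-\beta^2}\Bigr) - \sqrt{\frac{ct-\beta}{ct+\beta}}\; I_1\Bigl(\tfrac{\lambda}{c}\sqrt{c^2t^2-\beta^2}\Bigr)\Biggr]d\beta$$ $$= \frac{ct}{ct+\beta}\,P\{ M(t) \in d\beta,\ N(t)\text{ odd} \mid V(0) = c\} - \frac{c}{\lambda(ct+\beta)}\,P\{ M(t) \in d\beta,\ N(t)\text{ even} \mid V(0) = -c\} .$$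
   Context: Let $c>0$, $\lambda>0$. Let $V(0)$ be a random variable with $P\{V(0)=c\}=P\{V(0)=-c\}=\tfrac12$ and let $\{N(t)\}_{t\ge0}$ be a homogeneous Poisson process with rate $\lambda$, independent of $V(0)$. The symmetric telegraph process is $\mathcal{T}(t)=\int_0^t V(0)(-1)^{N(s)}\,ds$, $t\ge 0$ (so $\mathcal{T}(0)=0$). A formula $P\{X\in d\beta, E\mid A\}=f(\beta)\,d\beta$ for $0<\beta<ct$ means that the measure $B\mapsto P\{X\in B, E\mid A\}$, restricted to Borel subsets of $(0,ct)$, is absolutely continuous with density $f$. $I_\nu$ is the modified Bessel function of the first kind, $I_\nu(x)=\sum_{j\ge0}\frac{(x/2)^{2j+\nu}}{j!\,\Gamma(j+\nu+1)}$. *)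

theory Defs
  imports "HOL-Probability.Probability"
begin

locale poisson_process = prob_space M
  for M :: "'a measure" +
  fixes rate :: real and N :: "real \<Rightarrow> 'a \<Rightarrow> nat"
  assumes rate_pos: "rate > 0"
    and count_measurable: "\<And>t. 0 \<le> t \<Longrightarrow> N t \<in> measurable M (count_space UNIV)"
    and count_zero: "\<And>\<omega>. \<omega> \<in> space M \<Longrightarrow> N 0 \<omega> = 0"
    and count_mono: "\<And>\<omega> s t. \<omega> \<in> space M \<Longrightarrow> 0 \<le> s \<Longrightarrow> s \<le> t \<Longrightarrow> N s \<omega> \<le> N t \<omega>"
    and count_right_continuous:
      "\<And>\<omega> t. \<omega> \<in> space M \<Longrightarrow> 0 \<le> t \<Longrightarrow> continuous (at_right t) (\<lambda>s. N s \<omega>)"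
    and indep_increments:
      "\<And>(\<tau> :: nat \<Rightarrow> real) n. 0 \<le> \<tau> 0 \<Longrightarrow> mono \<tau> \<Longrightarrow>
         indep_vars (\<lambda>_. count_space UNIV) (\<lambda>i \<omega>. N (\<tau> (Suc i)) \<omega> - N (\<tau> i) \<omega>) {..<n}"
    and poisson_increments:
      "\<And>s t. 0 \<le> s \<Longrightarrow> s < t \<Longrightarrow>
         distr M (count_space UNIV) (\<lambda>\<omega>. N t \<omega> - N s \<omega>)
           = measure_pmf (poisson_pmf (rate * (t - s)))"

text \<open>The last assumption is independence of the initial velocity from the whole process
  \<^term>\<open>N\<close>, i.e. from the sigma-algebra generated by all \<^term>\<open>N t\<close> with \<^term>\<open>t \<ge> (0::real)\<close>.\<close>

locale symmetric_telegraph = poisson_process M rate N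
  for M :: "'a measure" and rate :: real and N :: "real \<Rightarrow> 'a \<Rightarrow> nat" +
  fixes c :: real and V0 :: "'a \<Rightarrow> real"
  assumes speed_pos: "c > 0"
    and V0_measurable: "V0 \<in> borel_measurable M"
    and prob_V0_pos: "\<P>(\<omega> in M. V0 \<omega> = c) = 1 / 2"
    and prob_V0_neg: "\<P>(\<omega> in M. V0 \<omega> = - c) = 1 / 2"
    and indep_V0_N:
      "indep_set
         (sets (vimage_algebra (space M) V0 borel))
         (sets (vimage_algebra (space M) (\<lambda>\<omega>. \<lambda>t\<in>{0..}. N t \<omega>)
                  (PiM {0..} (\<lambda>_. count_space UNIV))))"

definition telegraph :: "('a \<Rightarrow> real) \<Rightarrow> (real \<Rightarrow> 'a \<Rightarrow> nat) \<Rightarrow> real \<Rightarrow> 'a \<Rightarrow> real" where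
  "telegraph V0 N t \<omega> = (LBINT s:{0..t}. V0 \<omega> * (- 1) ^ N s \<omega>)"

text \<open>For a process with continuous paths, such as \<^const>\<open>telegraph\<close>, the supremum is a maximum.\<close>

definition running_max :: "(real \<Rightarrow> 'a \<Rightarrow> real) \<Rightarrow> real \<Rightarrow> 'a \<Rightarrow> real" where
  "running_max X t \<omega> = (SUP s\<in>{0..t}. X s \<omega>)"

text \<open>A natural number as order avoids \<open>powr\<close>, for which \<open>0 powr 0 = 0\<close>.\<close>

definition bessel_I :: "nat \<Rightarrow> real \<Rightarrow> real" where
  "bessel_I \<nu> x =
     (\<Sum>j. (x / 2) ^ (2 * j + \<nu>) / (fact j * Gamma (real j + real \<nu> + 1)))"

text \<open>The (in general defective) measure that maps \<open>B\<close> to the probability of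
  \<open>X \<in> B\<close> and \<open>E\<close> given \<open>A\<close>; see \<open>measure_cond_law\<close> below.\<close>

definition cond_law ::
  "'a measure \<Rightarrow> ('a \<Rightarrow> real) \<Rightarrow> ('a \<Rightarrow> bool) \<Rightarrow> ('a \<Rightarrow> bool) \<Rightarrow> real measure" where
  "cond_law M X E A =
     distr (restrict_space (uniform_measure M {\<omega> \<in> space M. A \<omega>}) {\<omega> \<in> space M. E \<omega>}) borel X"

lemma (in prob_space) measure_cond_law:
  assumes [measurable]: "X \<in> borel_measurable M" "Measurable.pred M E" "Measurable.pred M A"
    "B \<in> sets borel"
  shows "measure (cond_law M X E A) B = \<P>(\<omega> in M. X \<omega> \<in> B \<and> E \<omega> \<bar> A \<omega>)"
proof -
  let ?A = "{\<omega> \<in> space M. A \<omega>}" and ?E = "{\<omega> \<in> space M. E \<omega>}"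
  let ?R = "restrict_space (uniform_measure M ?A) ?E"
  have X: "X \<in> measurable ?R borel"
    by (rule measurable_restrict_space1) simp
  have "measure (cond_law M X E A) B = measure ?R (X -` B \<inter> space ?R)"
    unfolding cond_law_def by (rule measure_distr[OF X]) simp
  also have "X -` B \<inter> space ?R = {\<omega> \<in> space M. X \<omega> \<in> B \<and> E \<omega>}"
    by (auto simp: space_restrict_space)
  also have "measure ?R \<dots> = measure (uniform_measure M ?A) {\<omega> \<in> space M. X \<omega> \<in> B \<and> E \<omega>}"
    by (rule measure_restrict_space) auto
  also have "\<dots> = \<P>(\<omega> in M. X \<omega> \<in> B \<and> E \<omega> \<bar> A \<omega>)"
  proof (cases "prob ?A = 0")
    case True
    then have "emeasure M ?A = 0" by (simp add: emeasure_eq_measure)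
    moreover have "emeasure M (?A \<inter> {\<omega> \<in> space M. X \<omega> \<in> B \<and> E \<omega>}) \<le> emeasure M ?A"
      by (rule emeasure_mono) auto
    ultimately have "emeasure M (?A \<inter> {\<omega> \<in> space M. X \<omega> \<in> B \<and> E \<omega>}) = 0"
      by simp
    then have "measure (uniform_measure M ?A) {\<omega> \<in> space M. X \<omega> \<in> B \<and> E \<omega>} = 0"
      unfolding measure_def by (subst emeasure_uniform_measure) auto
    with True show ?thesis
      unfolding cond_prob_def by simp
  next
    case False
    then have "emeasure M ?A \<noteq> 0" by (simp add: emeasure_eq_measure)
    then show ?thesis
      by (subst measure_uniform_measure)
         (auto simp: cond_prob_def intro!: arg_cong2[where f="(/)"] arg_cong[where f=prob])
  qed
  finally show ?thesis .
qed

definition has_density_on :: "real measure \<Rightarrow> real set \<Rightarrow> (real \<Rightarrow> real) \<Rightarrow> bool" where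
  "has_density_on \<mu> S f \<longleftrightarrow>
     set_integrable lborel S f \<and>
     (\<forall>B\<in>sets borel. B \<subseteq> S \<longrightarrow> measure \<mu> B = (LBINT x:B. f x))"

end

theory Submission
  imports Defs
begin

text \<open>Take unit speed and let \<open>W\<close> be the displacement of a path started at time \<open>s\<close> in direction
  \<open>\<sigma> = \<plusminus>1\<close>. The probability that \<open>W\<close> exceeds the level \<open>b\<close> before time \<open>t\<close> with exactly \<open>n\<close> jumps
  in between is found by induction on \<open>n\<close>. Until the first jump the pair (elapsed time, remaining
  level) moves along a characteristic; after it, the process restarts in direction \<open>-\<sigma>\<close> with \<open>n - 1\<close>
  jumps. Splitting according to the number of jumps in a short initial interval gives the derivative
  of the probability along the characteristic, only the Markov property at deterministic times
  being used. In the light-cone coordinates \<open>x = (t - s - b)/2\<close>, \<open>y = (t - s + b)/2\<close> this derivative is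
  a partial derivative, and the solution is \<open>exp (- \<lambda> (t - s)) \<lambda>\<^sup>n\<close> times a truncated binomial sum in
  \<open>x\<close> and \<open>y\<close>. Differentiating in \<open>b\<close> leaves one or two monomials for each \<open>n\<close>, and
  summing these over the even or the odd \<open>n\<close> produces the Bessel functions.\<close>

text \<open>The first jump time never appears as a random variable. Only the number of jumps in an
  interval of length \<open>h\<close> is used, so the position of a jump inside it stays unknown and
  the level left to cross is known only up to \<open>h\<close>; two or more jumps have probability
  of order \<open>h^2\<close>. Both defects disappear in the limit: for \<open>n - 1\<close> jumps
  the probability is already known to be an exponential times a polynomial, hence continuous, and
  the difference quotient is squeezed from both sides. The constant of integration is read off where
  a characteristic leaves the region \<open>0 < b < t - s\<close>. An upward path arrives at level
  0, which it exceeds at once; a downward path arrives at the edge \<open>b = t - s\<close>, which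
  no path can exceed. Since a jump reverses the direction, the induction carries both directions
  together. Nothing is claimed at the end points of \<open>{0<..<c * t}\<close>, where the laws may
  have atoms.\<close>

section \<open>Truncated binomial sums\<close>

definition bipoly :: "(nat \<Rightarrow> real) \<Rightarrow> nat \<Rightarrow> real \<Rightarrow> real \<Rightarrow> real" where
  "bipoly w n x y = (\<Sum>j\<le>n. w j * (x ^ j / fact j) * (y ^ (n - j) / fact (n - j)))"

lemma continuous_bipoly [continuous_intros]:
  assumes "continuous F f" "continuous F g"
  shows "continuous F (\<lambda>x. bipoly w n (f x) (g x))"
  unfolding bipoly_def divide_inverse using assms by (intro continuous_intros)

text \<open>With the factorials divided out, differentiation lowers the degree without numerical
  factors: in the first variable it shifts the weights by one, in the second it leaves them
  alone.\<close>

lemma bipoly_deriv: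
  assumes f: "(f has_field_derivative f') (at r)" and g: "(g has_field_derivative g') (at r)"
  shows "((\<lambda>r. bipoly w (Suc n) (f r) (g r)) has_field_derivative
           f' * bipoly (w \<circ> Suc) n (f r) (g r) + g' * bipoly w n (f r) (g r)) (at r)"
proof -
  \<comment> \<open>\<open>p k\<close> is the derivative of \<open>z ^ k / k!\<close>. The value 0
    at \<open>k = 0\<close> is essential, because \<open>k - 1\<close> is truncated there; it
    removes the summand \<open>j = 0\<close> from the first sum below and \<open>j = Suc n\<close>
    from the second.\<close>
  define p where "p k z = (if k = 0 then 0 else z ^ (k - 1) / fact (k - 1))" for k and z :: real
  have p: "((\<lambda>r. h r ^ k / fact k) has_field_derivative h' * p k (h r)) (at r)"
    if "(h has_field_derivative h') (at r)" for h :: "real \<Rightarrow> real" and h' k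
  proof (cases k)
    case (Suc m)
    have "real (Suc m) * (h r ^ m * h') / fact (Suc m) = h' * (h r ^ m / fact m)"
      by (simp add: field_simps del: of_nat_Suc)
    moreover have "((\<lambda>r. h r ^ Suc m / fact (Suc m)) has_field_derivative
        real (Suc m) * (h r ^ m * h') / fact (Suc m)) (at r)"
      by (rule DERIV_cdivide, rule DERIV_cong[OF DERIV_power_Suc[OF that]]) simp
    ultimately show ?thesis
      using Suc by (simp add: p_def mult_ac)
  qed (simp add: p_def)
  have "((\<lambda>r. bipoly w (Suc n) (f r) (g r)) has_field_derivative
      (\<Sum>j\<le>Suc n. w j * (f' * p j (f r)) * (g r ^ (Suc n - j) / fact (Suc n - j))
         + w j * (f r ^ j / fact j) * (g' * p (Suc n - j) (g r)))) (at r)"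
    unfolding bipoly_def
    by (rule DERIV_sum, rule DERIV_cong[OF DERIV_mult[OF DERIV_cmult[OF p[OF f]] p[OF g]]]) simp
  also have "(\<Sum>j\<le>Suc n. w j * (f' * p j (f r)) * (g r ^ (Suc n - j) / fact (Suc n - j))
         + w j * (f r ^ j / fact j) * (g' * p (Suc n - j) (g r)))
      = (\<Sum>j\<le>Suc n. w j * (f' * p j (f r)) * (g r ^ (Suc n - j) / fact (Suc n - j)))
        + (\<Sum>j\<le>Suc n. w j * (f r ^ j / fact j) * (g' * p (Suc n - j) (g r)))"
    by (rule sum.distrib)
  also have "(\<Sum>j\<le>Suc n. w j * (f' * p j (f r)) * (g r ^ (Suc n - j) / fact (Suc n - j)))
      = f' * bipoly (w \<circ> Suc) n (f r) (g r)"
    unfolding bipoly_def sum_distrib_left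
    by (subst sum.atMost_Suc_shift) (simp add: p_def mult_ac)
  also have "(\<Sum>j\<le>Suc n. w j * (f r ^ j / fact j) * (g' * p (Suc n - j) (g r)))
      = g' * bipoly w n (f r) (g r)"
    unfolding bipoly_def sum_distrib_left
    by (auto simp: p_def Suc_diff_le mult_ac intro!: sum.cong)
  finally show ?thesis .
qed

lemma bipoly_diff_weights:
  "bipoly (\<lambda>j. v j - w j) n x y = bipoly v n x y - bipoly w n x y"
  by (simp add: bipoly_def left_diff_distrib diff_divide_distrib sum_subtractf)

text \<open>The weights 2, 1, 0 are those of the reflection principle for a simple random walk: paths that
  end above the level are counted twice, paths that end on it once.\<close>

definition tail_weight :: "real \<Rightarrow> nat \<Rightarrow> nat \<Rightarrow> real" where
  "tail_weight \<sigma> n j =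
     (let m = (if \<sigma> > 0 then n else Suc n) in if 2 * j > m then 2 else if 2 * j = m then 1 else 0)"

text \<open>These are the weight recursions demanded by \<open>bipoly_deriv\<close>: unchanged index
  for an upward start, shifted index for a downward start. The threshold \<open>Suc n\<close> in
  place of \<open>n\<close> for \<open>\<sigma> = - 1\<close> makes both of them exact.\<close>

lemma tail_weight_Suc:
  "tail_weight 1 (Suc n) j = tail_weight (- 1) n j"
  "tail_weight (- 1) (Suc n) (Suc j) = tail_weight 1 n j"
  by (auto simp: tail_weight_def)

lemma bipoly_diagonal: "bipoly (\<lambda>_. 1) n x x = (2 * x) ^ n / fact n"
proof -
  have "(2 * x) ^ n = (\<Sum>j\<le>n. of_nat (n choose j) * x ^ j * x ^ (n - j))"
    using binomial_ring[of x x n] by simp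
  also have "\<dots> = fact n * bipoly (\<lambda>_. 1) n x x"
    unfolding bipoly_def sum_distrib_left
    by (intro sum.cong refl) (simp add: binomial_fact field_simps)
  finally show ?thesis by simp
qed

text \<open>On the diagonal the sum may be reversed, and the weights at \<open>j\<close> and
  \<open>n - j\<close> add up to 2. Hence on average the weight is 1 and the binomial theorem
  applies.\<close>

lemma bipoly_tail_weight_diagonal: "bipoly (tail_weight 1 n) n x x = (2 * x) ^ n / fact n"
proof -
  have "bipoly (tail_weight 1 n) n x x = bipoly (\<lambda>j. tail_weight 1 n (n - j)) n x x"
    unfolding bipoly_def by (subst sum.nat_diff_reindex[symmetric, of _ "Suc n", unfolded lessThan_Suc_atMost])
      (auto intro!: sum.cong simp: mult_ac)
  then have "2 * bipoly (tail_weight 1 n) n x x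
      = bipoly (tail_weight 1 n) n x x + bipoly (\<lambda>j. tail_weight 1 n (n - j)) n x x"
    by simp
  also have "\<dots> = 2 * bipoly (\<lambda>_. 1) n x x"
    unfolding bipoly_def sum_distrib_left sum.distrib[symmetric]
    by (intro sum.cong refl) (auto simp: tail_weight_def algebra_simps)
  finally show ?thesis by (simp add: bipoly_diagonal)
qed

definition tail_poly :: "real \<Rightarrow> nat \<Rightarrow> real \<Rightarrow> real \<Rightarrow> real" where
  "tail_poly \<sigma> n d b = bipoly (tail_weight \<sigma> n) n ((d - b) / 2) ((d + b) / 2)"

text \<open>Moving upward keeps \<open>(d - b) / 2\<close> fixed and moving downward keeps
  \<open>(d + b) / 2\<close> fixed, so one of the two terms of \<open>bipoly_deriv\<close> vanishes;
  the weight recursion turns the other into the polynomial for the reversed direction.\<close>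

lemma tail_poly_characteristic:
  assumes "\<sigma> = 1 \<or> \<sigma> = - 1"
  shows "((\<lambda>r. tail_poly \<sigma> (Suc n) (d - r) (b - \<sigma> * r)) has_field_derivative
           - tail_poly (- \<sigma>) n (d - r) (b - \<sigma> * r)) (at r)"
  using assms
proof
  assume [simp]: "\<sigma> = 1"
  have "((\<lambda>r. bipoly (tail_weight 1 (Suc n)) (Suc n) ((d - b) / 2) ((d + b) / 2 - r))
      has_field_derivative
        0 * bipoly (tail_weight 1 (Suc n) \<circ> Suc) n ((d - b) / 2) ((d + b) / 2 - r)
        + (- 1) * bipoly (tail_weight 1 (Suc n)) n ((d - b) / 2) ((d + b) / 2 - r)) (at r)"
    by (rule bipoly_deriv) (auto intro!: derivative_eq_intros)
  moreover have "tail_poly 1 m (d - r) (b - r)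
      = bipoly (tail_weight 1 m) m ((d - b) / 2) ((d + b) / 2 - r)"
    "tail_poly (- 1) m (d - r) (b - r)
      = bipoly (tail_weight (- 1) m) m ((d - b) / 2) ((d + b) / 2 - r)" for m r
    unfolding tail_poly_def by (auto intro!: arg_cong2[where f="bipoly _ _"] simp: field_simps)
  ultimately show ?thesis
    by (simp add: tail_weight_Suc[abs_def])
next
  assume [simp]: "\<sigma> = - 1"
  have "((\<lambda>r. bipoly (tail_weight (- 1) (Suc n)) (Suc n) ((d - b) / 2 - r) ((d + b) / 2))
      has_field_derivative
        (- 1) * bipoly (tail_weight (- 1) (Suc n) \<circ> Suc) n ((d - b) / 2 - r) ((d + b) / 2)
        + 0 * bipoly (tail_weight (- 1) (Suc n)) n ((d - b) / 2 - r) ((d + b) / 2)) (at r)"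
    by (rule bipoly_deriv) (auto intro!: derivative_eq_intros)
  moreover have "tail_poly 1 m (d - r) (b + r)
      = bipoly (tail_weight 1 m) m ((d - b) / 2 - r) ((d + b) / 2)"
    "tail_poly (- 1) m (d - r) (b + r)
      = bipoly (tail_weight (- 1) m) m ((d - b) / 2 - r) ((d + b) / 2)" for m r
    unfolding tail_poly_def by (auto intro!: arg_cong2[where f="bipoly _ _"] simp: field_simps)
  ultimately show ?thesis
    by (simp add: tail_weight_Suc o_def)
qed

lemma tail_poly_diagonal: "tail_poly 1 n d 0 = d ^ n / fact n"
  by (simp add: tail_poly_def bipoly_tail_weight_diagonal)

text \<open>The first variable is 0, which leaves only the summand \<open>j = 0\<close>, and its
  weight is 0 for a downward start, even when \<open>n = 0\<close>.\<close>

lemma tail_poly_edge: "tail_poly (- 1) n d d = 0"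
  unfolding tail_poly_def bipoly_def by (rule sum.neutral) (auto simp: tail_weight_def power_0_left)

lemma continuous_tail_poly [continuous_intros]:
  assumes "continuous F f" "continuous F g"
  shows "continuous F (\<lambda>x. tail_poly \<sigma> n (f x) (g x))"
  unfolding tail_poly_def divide_inverse using assms by (intro continuous_intros)

section \<open>Displacement driven by a counting path\<close>

definition parity_displacement :: "(real \<Rightarrow> 'a \<Rightarrow> nat) \<Rightarrow> 'a \<Rightarrow> real \<Rightarrow> real \<Rightarrow> real" where
  "parity_displacement X \<omega> s r = (LBINT u:{s..r}. (- 1) ^ X u \<omega>)"

lemma eventually_at_right_eq_nat:
  fixes f :: "real \<Rightarrow> nat"
  assumes "continuous (at_right s) f"
  shows "eventually (\<lambda>u. f u = f s) (at_right s)"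
  using assms unfolding continuous_within nhds_discrete filterlim_principal by simp

text \<open>Paths are only right continuous, so time is approximated from the right by grid points.
  Replacing \<open>u\<close> by \<open>max s u\<close> keeps the time argument where
  \<open>X\<close> is assumed measurable.\<close>

lemma parity_jointly_measurable:
  fixes R :: "'a measure" and X :: "real \<Rightarrow> 'a \<Rightarrow> nat"
  assumes X: "\<And>u. s \<le> u \<Longrightarrow> X u \<in> measurable R (count_space UNIV)"
    and rc: "\<And>\<omega> u. \<omega> \<in> space R \<Longrightarrow> s \<le> u \<Longrightarrow> continuous (at_right u) (\<lambda>v. X v \<omega>)"
  shows "(\<lambda>(\<omega>, u). (- 1) ^ X (max s u) \<omega> :: real) \<in> borel_measurable (R \<Otimes>\<^sub>M lborel)"
proof (rule borel_measurable_LIMSEQ_real)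
  \<comment> \<open>\<open>g m u\<close> is the first point strictly to the right of
    \<open>u\<close> in the grid of mesh \<open>1 / Suc m\<close>; strictness is what lets right
    continuity apply.\<close>
  define g where "g m u = (of_int \<lfloor>real (Suc m) * u\<rfloor> + 1) / real (Suc m)" for m :: nat and u :: real
  show "(\<lambda>(\<omega>, u). (- 1) ^ X (max s (g m (max s u))) \<omega> :: real) \<in> borel_measurable (R \<Otimes>\<^sub>M lborel)"
    for m
  proof -
    have [measurable]: "X (max s v) \<in> measurable R (count_space UNIV)" for v
      by (rule X) simp
    define f :: "int \<Rightarrow> 'a \<times> real \<Rightarrow> real"
      where "f i p = (- 1) ^ X (max s ((of_int i + 1) / real (Suc m))) (fst p)" for i p
    have [measurable]: "f i \<in> borel_measurable (R \<Otimes>\<^sub>M lborel)" for i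
      unfolding f_def by measurable
    \<comment> \<open>The grid index takes countably many values, and for each fixed index the
      function depends on the outcome alone.\<close>
    have "(\<lambda>p. f \<lfloor>real (Suc m) * max s (snd p)\<rfloor> p) \<in> borel_measurable (R \<Otimes>\<^sub>M lborel)"
      by (rule measurable_compose_countable[of f, OF _ measurable_compose[OF _ measurable_real_floor]])
        measurable
    then show ?thesis
      unfolding f_def g_def split_beta' .
  qed
  fix p :: "'a \<times> real" assume "p \<in> space (R \<Otimes>\<^sub>M lborel)"
  then obtain \<omega> u where p: "p = (\<omega>, u)" and \<omega>: "\<omega> \<in> space R"
    by (auto simp: space_pair_measure)
  define v where "v = max s u"
  have gt: "v < g m v" for m
  proof -
    have "v * real (Suc m) < of_int \<lfloor>real (Suc m) * v\<rfloor> + 1" by (simp only: mult.commute[of v]) linarith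
    then show ?thesis unfolding g_def by (subst pos_less_divide_eq) simp_all
  qed
  have le: "g m v \<le> v + 1 / real (Suc m)" for m
  proof -
    have "of_int \<lfloor>real (Suc m) * v\<rfloor> + 1 \<le> real (Suc m) * v + 1" by linarith
    then have "g m v \<le> (real (Suc m) * v + 1) / real (Suc m)"
      unfolding g_def by (rule divide_right_mono) simp
    also have "\<dots> = v + 1 / real (Suc m)"
      by (simp add: add_divide_distrib del: of_nat_Suc)
    finally show ?thesis .
  qed
  have "(\<lambda>m. v + 1 / real (Suc m)) \<longlonglongrightarrow> v + 0"
    by (rule tendsto_add[OF tendsto_const LIMSEQ_Suc[OF lim_1_over_n]])
  then have upper: "(\<lambda>m. v + 1 / real (Suc m)) \<longlonglongrightarrow> v"
    by (simp only: add_0_right)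
  have "(\<lambda>m. g m v) \<longlonglongrightarrow> v"
  proof (rule tendsto_sandwich[OF _ _ tendsto_const upper])
    show "eventually (\<lambda>m. v \<le> g m v) sequentially"
      by (rule always_eventually, rule allI, rule less_imp_le, rule gt)
    show "eventually (\<lambda>m. g m v \<le> v + 1 / real (Suc m)) sequentially"
      by (rule always_eventually, rule allI, rule le)
  qed
  then have "filterlim (\<lambda>m. g m v) (at_right v) sequentially"
    unfolding filterlim_at
  proof (rule conjI[rotated])
    have "g m v \<in> {v<..} \<and> g m v \<noteq> v" for m
      using gt[of m] by (metis greaterThan_iff less_irrefl)
    then show "eventually (\<lambda>m. g m v \<in> {v<..} \<and> g m v \<noteq> v) sequentially"
      by (rule always_eventually[OF allI])
  qed
  moreover have "eventually (\<lambda>w. X w \<omega> = X v \<omega>) (at_right v)"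
    by (rule eventually_at_right_eq_nat, rule rc[OF \<omega>]) (simp add: v_def)
  ultimately have "eventually (\<lambda>m. X (g m v) \<omega> = X v \<omega>) sequentially"
    by (rule eventually_compose_filterlim[rotated])
  moreover have "max s (g m v) = g m v" for m
    using gt[of m] by (simp add: v_def)
  ultimately show "(\<lambda>m. (\<lambda>(\<omega>, u). (- 1) ^ X (max s (g m (max s u))) \<omega> :: real) p)
      \<longlonglongrightarrow> (\<lambda>(\<omega>, u). (- 1) ^ X (max s u) \<omega>) p"
    unfolding p prod.case v_def[symmetric]
    by (intro tendsto_eventually) (simp add: eventually_mono)
qed

text \<open>The measure is left open because the facts are needed twice: for the full sigma-algebra
  and for the one generated by the increments after \<open>s\<close>.\<close>

locale counting_family =
  fixes R :: "'a measure" and X :: "real \<Rightarrow> 'a \<Rightarrow> nat" and s :: real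
  assumes family_measurable: "\<And>u. s \<le> u \<Longrightarrow> X u \<in> measurable R (count_space UNIV)"
    and family_right_continuous:
      "\<And>\<omega> u. \<omega> \<in> space R \<Longrightarrow> s \<le> u \<Longrightarrow> continuous (at_right u) (\<lambda>v. X v \<omega>)"
begin

lemma parity_set_integrable:
  assumes "\<omega> \<in> space R" "s \<le> a"
  shows "set_integrable lborel {a..r} (\<lambda>u. (- 1) ^ X u \<omega> :: real)"
proof (rule set_integrable_bound)
  show "set_integrable lborel {a..r} (\<lambda>_. 1 :: real)"
    by (simp add: set_integrable_def integrable_real_indicator emeasure_lborel_Icc_eq)
  have "(\<lambda>u. (- 1) ^ X (max s u) \<omega> :: real) \<in> borel_measurable lborel"
    using measurable_compose[OF measurable_Pair1'[OF assms(1)]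
        parity_jointly_measurable[OF family_measurable family_right_continuous]]
    by simp
  then have "set_borel_measurable lborel {a..r} (\<lambda>u. (- 1) ^ X (max s u) \<omega> :: real)"
    unfolding set_borel_measurable_def by measurable
  moreover have "indicator {a..r} u *\<^sub>R ((- 1) ^ X (max s u) \<omega> :: real)
      = indicator {a..r} u *\<^sub>R (- 1) ^ X u \<omega>" for u
    using assms(2) by (auto simp: indicator_def max_def)
  ultimately show "set_borel_measurable lborel {a..r} (\<lambda>u. (- 1) ^ X u \<omega> :: real)"
    unfolding set_borel_measurable_def by (simp only:)
qed (auto simp: power_abs)

lemma parity_displacement_measurable:
  "(\<lambda>\<omega>. parity_displacement X \<omega> s r) \<in> borel_measurable R"
proof -
  have [measurable]: "(\<lambda>(\<omega>, u). (- 1) ^ X (max s u) \<omega> :: real) \<in> borel_measurable (R \<Otimes>\<^sub>M lborel)"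
    by (rule parity_jointly_measurable[OF family_measurable family_right_continuous])
  have "indicator {s..r} u *\<^sub>R ((- 1) ^ X (max s u) \<omega> :: real)
      = indicator {s..r} u *\<^sub>R (- 1) ^ X u \<omega>" for u \<omega>
    by (auto simp: indicator_def max_def)
  then have eq: "(\<lambda>\<omega>. LBINT u. indicator {s..r} u *\<^sub>R ((- 1) ^ X (max s u) \<omega> :: real))
      = (\<lambda>\<omega>. LBINT u. indicator {s..r} u *\<^sub>R (- 1) ^ X u \<omega>)"
    by presburger
  show ?thesis
    unfolding parity_displacement_def set_lebesgue_integral_def eq[symmetric] by measurable
qed

lemma parity_displacement_combine:
  assumes "\<omega> \<in> space R" "s \<le> a" "a \<le> b" "b \<le> r"
  shows "parity_displacement X \<omega> a r = parity_displacement X \<omega> a b + parity_displacement X \<omega> b r"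
proof -
  have "AE u in lborel. \<not> (u \<in> {a..b} \<and> u \<in> {b..r})"
    using AE_lborel_singleton[of b] by eventually_elim auto
  then have "parity_displacement X \<omega> a b + parity_displacement X \<omega> b r
      = (LBINT u:{a..b} \<union> {b..r}. (- 1) ^ X u \<omega>)"
    unfolding parity_displacement_def
    by (intro set_integral_Un_AE[symmetric] parity_set_integrable) (use assms in auto)
  also have "{a..b} \<union> {b..r} = {a..r}"
    using assms by auto
  finally show ?thesis
    by (simp add: parity_displacement_def)
qed

lemma abs_parity_displacement_le:
  assumes "\<omega> \<in> space R" "s \<le> a" "a \<le> r"
  shows "\<bar>parity_displacement X \<omega> a r\<bar> \<le> r - a"
proof -
  have "norm (parity_displacement X \<omega> a r) \<le> (LBINT u:{a..r}. norm ((- 1) ^ X u \<omega> :: real))"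
    unfolding parity_displacement_def by (rule set_integral_norm_bound[OF parity_set_integrable[OF assms(1,2)]])
  also have "\<dots> = r - a"
    using assms(3) by (simp add: power_abs set_lebesgue_integral_def)
  finally show ?thesis by simp
qed

text \<open>Paths are Lipschitz and the inequality is strict, so exceeding the level at some time is
  the same as exceeding it at some rational time, a countable union.\<close>

lemma exceeds_measurable:
  assumes [measurable]: "V \<in> borel_measurable R" and "s \<le> t"
  shows "{\<omega> \<in> space R. \<exists>r\<in>{s..t}. b < V \<omega> * parity_displacement X \<omega> s r} \<in> sets R"
proof -
  \<comment> \<open>Clipping the rational to \<open>{s..t}\<close> takes care of
    \<open>r = t\<close>, which has no point of the interval to its right.\<close>
  have *: "(\<exists>r\<in>{s..t}. b < V \<omega> * parity_displacement X \<omega> s r) \<longleftrightarrow>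
      (\<exists>q::rat. b < V \<omega> * parity_displacement X \<omega> s (max s (min t (of_rat q))))"
    if \<omega>: "\<omega> \<in> space R" for \<omega>
  proof
    assume "\<exists>r\<in>{s..t}. b < V \<omega> * parity_displacement X \<omega> s r"
    then obtain r where r: "s \<le> r" "r \<le> t" "b < V \<omega> * parity_displacement X \<omega> s r"
      by auto
    \<comment> \<open>During a time \<open>e\<close> the path cannot lose its surplus over
      \<open>b\<close>. The summand 1 in the denominator covers
      \<open>V \<omega> = 0\<close>.\<close>
    define e where "e = (V \<omega> * parity_displacement X \<omega> s r - b) / (\<bar>V \<omega>\<bar> + 1)"
    have "0 < e"
      using r unfolding e_def by (intro divide_pos_pos) auto
    then obtain q :: rat where q: "r < of_rat q" "of_rat q < r + e"
      using of_rat_dense[of r "r + e"] by auto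
    let ?q = "max s (min t (of_rat q))"
    have q': "r \<le> ?q" "?q < r + e"
      using q r \<open>0 < e\<close> by auto
    have "\<bar>V \<omega> * parity_displacement X \<omega> r ?q\<bar> \<le> \<bar>V \<omega>\<bar> * (?q - r)"
      unfolding abs_mult
      by (intro mult_left_mono abs_parity_displacement_le[OF \<omega> r(1) q'(1)]) simp
    also have "\<dots> \<le> (\<bar>V \<omega>\<bar> + 1) * (?q - r)"
      using q' by (intro mult_right_mono) auto
    also have "\<dots> < (\<bar>V \<omega>\<bar> + 1) * e"
      using q' by (intro mult_strict_left_mono) auto
    also have "\<dots> = V \<omega> * parity_displacement X \<omega> s r - b"
      by (simp add: e_def)
    finally have "b < V \<omega> * (parity_displacement X \<omega> s r + parity_displacement X \<omega> r ?q)"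
      by (simp add: algebra_simps abs_le_iff)
    also have "parity_displacement X \<omega> s r + parity_displacement X \<omega> r ?q
        = parity_displacement X \<omega> s ?q"
      by (rule parity_displacement_combine[symmetric, OF \<omega> order_refl r(1) q'(1)])
    finally show "\<exists>q::rat. b < V \<omega> * parity_displacement X \<omega> s (max s (min t (of_rat q)))" ..
  qed (use \<open>s \<le> t\<close> in auto)
  have [measurable]: "(\<lambda>\<omega>. parity_displacement X \<omega> s r) \<in> borel_measurable R" for r
    by (rule parity_displacement_measurable)
  have "{\<omega> \<in> space R. \<exists>q::rat. b < V \<omega> * parity_displacement X \<omega> s (max s (min t (of_rat q)))} \<in> sets R"
    by measurable
  then show ?thesis
    using * by (simp cong: conj_cong)
qed

end

section \<open>Independence of the future increments\<close>

context poisson_process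
begin

definition increment :: "real \<Rightarrow> real \<Rightarrow> 'a \<Rightarrow> nat" where
  "increment s u \<omega> = N u \<omega> - N s \<omega>"

text \<open>Generated by increments from \<open>s\<close> on, not by the counts, so that it is
  independent of the jumps before \<open>s\<close>.\<close>

definition future :: "real \<Rightarrow> 'a measure" where
  "future s = vimage_algebra (space M) (\<lambda>\<omega>. \<lambda>u\<in>{s..}. increment s u \<omega>)
     (PiM {s..} (\<lambda>_. count_space UNIV))"

lemma space_future [simp]: "space (future s) = space M"
  by (simp add: future_def)

lemma increment_measurable [measurable]:
  assumes "0 \<le> s" "s \<le> u"
  shows "increment s u \<in> measurable M (count_space UNIV)"
proof -
  have [measurable]: "N s \<in> measurable M (count_space UNIV)" "N u \<in> measurable M (count_space UNIV)"
    using assms by (auto intro: count_measurable)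
  show ?thesis
    unfolding increment_def by measurable
qed

lemma increment_add:
  assumes "\<omega> \<in> space M" "0 \<le> s" "s \<le> s'" "s' \<le> u"
  shows "increment s u \<omega> = increment s s' \<omega> + increment s' u \<omega>"
  using count_mono[of \<omega> s s'] count_mono[of \<omega> s' u] assms by (simp add: increment_def)

lemma increment_right_continuous:
  assumes "\<omega> \<in> space M" "0 \<le> u"
  shows "continuous (at_right u) (\<lambda>v. increment s v \<omega>)"
proof -
  have "eventually (\<lambda>v. N v \<omega> = N u \<omega>) (at_right u)"
    by (intro eventually_at_right_eq_nat count_right_continuous assms)
  then have "eventually (\<lambda>v. increment s v \<omega> = increment s u \<omega>) (at_right u)"
    by eventually_elim (simp add: increment_def)
  then show ?thesis
    unfolding continuous_within by (rule tendsto_eventually)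
qed

lemma counting_family_increment: "0 \<le> s \<Longrightarrow> counting_family M (increment s) s"
  by unfold_locales (auto intro: increment_measurable increment_right_continuous)

lemma increment_measurable_future:
  assumes "s \<le> u"
  shows "increment s u \<in> measurable (future s) (count_space UNIV)"
proof -
  have "(\<lambda>f. f u) \<in> measurable (PiM {s..} (\<lambda>_. count_space UNIV)) (count_space (UNIV :: nat set))"
    using assms by (intro measurable_component_singleton) auto
  moreover have "(\<lambda>\<omega>. \<lambda>u\<in>{s..}. increment s u \<omega>)
      \<in> measurable (future s) (PiM {s..} (\<lambda>_. count_space UNIV))"
    unfolding future_def by (rule measurable_vimage_algebra1) (auto simp: space_PiM)
  ultimately have "(\<lambda>\<omega>. (\<lambda>u\<in>{s..}. increment s u \<omega>) u) \<in> measurable (future s) (count_space UNIV)"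
    by (rule measurable_compose[rotated])
  then show ?thesis
    using assms by simp
qed

lemma counting_family_future: "0 \<le> s \<Longrightarrow> counting_family (future s) (increment s) s"
  by unfold_locales (auto intro: increment_measurable_future increment_right_continuous)

lemma prob_increment:
  assumes "0 \<le> s" "s < u"
  shows "prob {\<omega> \<in> space M. increment s u \<omega> = k}
    = exp (- (rate * (u - s))) * (rate * (u - s)) ^ k / fact k"
proof -
  have [measurable]: "increment s u \<in> measurable M (count_space UNIV)"
    using assms by (intro increment_measurable) auto
  have "prob {\<omega> \<in> space M. increment s u \<omega> = k}
      = measure (distr M (count_space UNIV) (increment s u)) {k}"
    by (subst measure_distr) (auto intro!: arg_cong[where f=prob])
  also have "distr M (count_space UNIV) (increment s u) = measure_pmf (poisson_pmf (rate * (u - s)))"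
    using poisson_increments[OF assms] by (simp add: increment_def[abs_def])
  also have "measure \<dots> {k} = pmf (poisson_pmf (rate * (u - s))) k"
    by (simp add: measure_pmf_single)
  finally show ?thesis
    using assms rate_pos by (simp add: mult_ac)
qed

text \<open>Sorting the times of \<open>J\<close> after \<open>s\<close> and \<open>s'\<close> gives
  consecutive increments, which are independent. Increments counted from \<open>s'\<close> are
  partial sums of the block that omits the first one.\<close>

lemma indep_increment_cylinder:
  assumes s: "0 \<le> s" "s \<le> s'" and J: "finite J" "J \<subseteq> {s'..}"
  shows "prob ({\<omega> \<in> space M. increment s s' \<omega> = k} \<inter> {\<omega> \<in> space M. \<forall>j\<in>J. increment s' j \<omega> \<in> E j})
    = prob {\<omega> \<in> space M. increment s s' \<omega> = k} * prob {\<omega> \<in> space M. \<forall>j\<in>J. increment s' j \<omega> \<in> E j}"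
proof -
  define L where "L = sorted_list_of_set J"
  define n where "n = length L"
  have set_L: "set L = J" and "sorted L"
    using J by (auto simp: L_def)
  \<comment> \<open>Independence is assumed along infinite monotone sequences of times; capping the
    index at the last position \<open>Suc n\<close> of the list continues it by a constant.\<close>
  define \<tau> where "\<tau> i = (s # s' # L) ! min i (Suc n)" for i
  have sorted: "sorted (s # s' # L)"
    using \<open>sorted L\<close> set_L J s by auto
  have "mono \<tau>"
    unfolding \<tau>_def by (intro monoI sorted_nth_mono[OF sorted]) (auto simp: n_def)
  have \<tau>0: "\<tau> 0 = s" and \<tau>1: "\<tau> (Suc 0) = s'" and \<tau>2: "i < n \<Longrightarrow> \<tau> (Suc (Suc i)) = L ! i" for i
    by (auto simp: \<tau>_def)
  define Y where "Y i \<omega> = N (\<tau> (Suc i)) \<omega> - N (\<tau> i) \<omega>" for i \<omega>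
  let ?B = "{1..<Suc n}"
  have \<tau>_nonneg: "0 \<le> \<tau> i" for i
    using monoD[OF \<open>mono \<tau>\<close>, of 0 i] \<tau>0 s by simp
  have "indep_vars (\<lambda>_. count_space UNIV) Y {..<Suc n}"
    using indep_increments[OF _ \<open>mono \<tau>\<close>, of "Suc n"] \<tau>_nonneg by (simp add: Y_def[abs_def])
  then have ind: "indep_var (PiM {0} (\<lambda>_. count_space UNIV)) (\<lambda>\<omega>. restrict (\<lambda>i. Y i \<omega>) {0})
      (PiM ?B (\<lambda>_. count_space UNIV)) (\<lambda>\<omega>. restrict (\<lambda>i. Y i \<omega>) ?B)"
    by (rule indep_var_restrict) auto
  have telescope: "increment s' (L ! i) \<omega> = (\<Sum>m\<in>{1..<Suc (Suc i)}. Y m \<omega>)"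
    if \<omega>: "\<omega> \<in> space M" and "i < n" for \<omega> i
  proof -
    \<comment> \<open>The subtractions are truncated, so the telescoping relies on the monotonicity
      of the counts.\<close>
    have "N (\<tau> (Suc (Suc i))) \<omega> - N (\<tau> 1) \<omega> = (\<Sum>m\<in>{1..<Suc (Suc i)}. Y m \<omega>)" for i
    proof (induction i)
      case (Suc i)
      have "N (\<tau> 1) \<omega> \<le> N (\<tau> (Suc (Suc i))) \<omega>"
        "N (\<tau> (Suc (Suc i))) \<omega> \<le> N (\<tau> (Suc (Suc (Suc i)))) \<omega>"
        by (intro count_mono[OF \<omega> \<tau>_nonneg] monoD[OF \<open>mono \<tau>\<close>]; simp)+
      then show ?case
        using Suc by (simp add: Y_def)
    qed (simp add: Y_def)
    from this[of i] show ?thesis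
      unfolding increment_def \<tau>2[OF \<open>i < n\<close>] One_nat_def \<tau>1 .
  qed
  let ?C0 = "{f \<in> space (PiM {0::nat} (\<lambda>_. count_space (UNIV::nat set))). f 0 = k}"
  let ?C1 = "{f \<in> space (PiM ?B (\<lambda>_. count_space (UNIV::nat set))).
      \<forall>i<n. (\<Sum>m\<in>{1..<Suc (Suc i)}. f m) \<in> E (L ! i)}"
  have C0: "?C0 \<in> sets (PiM {0::nat} (\<lambda>_. count_space (UNIV::nat set)))"
    by measurable
  have C1: "?C1 \<in> sets (PiM ?B (\<lambda>_. count_space (UNIV::nat set)))"
  proof -
    have "{f \<in> space (PiM ?B (\<lambda>_. count_space UNIV)). (\<Sum>m\<in>{1..<Suc (Suc i)}. f m) \<in> E (L ! i)}
        \<in> sets (PiM ?B (\<lambda>_. count_space (UNIV::nat set)))" if "i < n" for i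
    proof -
      have "(\<lambda>f. \<Sum>m\<in>{1..<Suc (Suc i)}. f m)
          \<in> measurable (PiM ?B (\<lambda>_. count_space (UNIV::nat set))) (count_space UNIV)"
        using that by (intro measurable_sum_nat measurable_component_singleton) auto
      from measurable_sets[OF this, of "E (L ! i)"] show ?thesis
        by (simp add: vimage_def Int_def conj_commute)
    qed
    then have "{f \<in> space (PiM ?B (\<lambda>_. count_space (UNIV::nat set))).
        \<forall>i\<in>{..<n}. (\<Sum>m\<in>{1..<Suc (Suc i)}. f m) \<in> E (L ! i)}
        \<in> sets (PiM ?B (\<lambda>_. count_space (UNIV::nat set)))"
      by (intro sets.sets_Collect_finite_All finite_lessThan) (simp only: lessThan_iff)
    moreover have "(\<forall>i\<in>{..<n}. P i) \<longleftrightarrow> (\<forall>i<n. P i)" for P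
      by blast
    ultimately show ?thesis
      by (simp only:)
  qed
  have e0: "(\<lambda>\<omega>. restrict (\<lambda>i. Y i \<omega>) {0}) -` ?C0 \<inter> space M
      = {\<omega> \<in> space M. increment s s' \<omega> = k}"
    using \<tau>0 \<tau>1 by (auto simp: space_PiM Y_def increment_def)
  have e1: "(\<lambda>\<omega>. restrict (\<lambda>i. Y i \<omega>) ?B) -` ?C1 \<inter> space M
      = {\<omega> \<in> space M. \<forall>j\<in>J. increment s' j \<omega> \<in> E j}"
  proof -
    have sum_eq: "(\<Sum>m\<in>{1..<Suc (Suc i)}. restrict (\<lambda>i. Y i \<omega>) ?B m) = increment s' (L ! i) \<omega>"
      if "\<omega> \<in> space M" "i < n" for \<omega> i
      unfolding telescope[OF that] using that by (intro sum.cong) auto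
    have "(\<lambda>\<omega>. restrict (\<lambda>i. Y i \<omega>) ?B) -` ?C1 \<inter> space M
        = {\<omega> \<in> space M. \<forall>i<n. (\<Sum>m\<in>{1..<Suc (Suc i)}. restrict (\<lambda>i. Y i \<omega>) ?B m) \<in> E (L ! i)}"
      by (auto simp: space_PiM simp del: sum.op_ivl_Suc)
    also have "\<dots> = {\<omega> \<in> space M. \<forall>i<n. increment s' (L ! i) \<omega> \<in> E (L ! i)}"
      by (intro Collect_cong conj_cong all_cong refl) (simp only: sum_eq)
    also have "\<dots> = {\<omega> \<in> space M. \<forall>j\<in>J. increment s' j \<omega> \<in> E j}"
      unfolding set_L[symmetric] all_set_conv_all_nth n_def ..
    finally show ?thesis .
  qed
  have "prob (((\<lambda>\<omega>. restrict (\<lambda>i. Y i \<omega>) {0}) -` ?C0 \<inter> space M)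
        \<inter> ((\<lambda>\<omega>. restrict (\<lambda>i. Y i \<omega>) ?B) -` ?C1 \<inter> space M))
      = prob ((\<lambda>\<omega>. (restrict (\<lambda>i. Y i \<omega>) {0}, restrict (\<lambda>i. Y i \<omega>) ?B)) -` (?C0 \<times> ?C1) \<inter> space M)"
    by (rule arg_cong[where f = prob]) auto
  also have "\<dots>
      = prob ((\<lambda>\<omega>. restrict (\<lambda>i. Y i \<omega>) {0}) -` ?C0 \<inter> space M)
        * prob ((\<lambda>\<omega>. restrict (\<lambda>i. Y i \<omega>) ?B) -` ?C1 \<inter> space M)"
    by (rule indep_varD[OF ind C0 C1])
  finally show ?thesis
    unfolding e0 e1 .
qed

text \<open>The Markov property at a deterministic time: independence extends from the
  intersection-stable cylinder events to the sigma-algebra that they generate.\<close>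

lemma indep_increment_future:
  assumes s: "0 \<le> s" "s \<le> s'" and A: "A \<in> sets (future s')"
  shows "prob ({\<omega> \<in> space M. increment s s' \<omega> = k} \<inter> A)
    = prob {\<omega> \<in> space M. increment s s' \<omega> = k} * prob A"
proof -
  let ?K = "{\<omega> \<in> space M. increment s s' \<omega> = k}"
  let ?P = "\<lambda>_::real. count_space (UNIV :: nat set)"
  let ?\<Omega> = "\<Pi>\<^sub>E u\<in>{s'..}. space (?P u)"
  define \<Phi> where "\<Phi> \<omega> = (\<lambda>u\<in>{s'..}. increment s' u \<omega>)" for \<omega>
  define G where "G = {\<Phi> -` C \<inter> space M | C. C \<in> prod_algebra {s'..} ?P}"
  have \<Phi>: "\<Phi> \<in> space M \<rightarrow> ?\<Omega>"
    by (auto simp: \<Phi>_def)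
  have \<Phi>_meas: "\<Phi> \<in> measurable M (PiM {s'..} ?P)"
    unfolding \<Phi>_def by (intro measurable_restrict increment_measurable) (use s in auto)
  have K: "?K \<in> events"
    using measurable_sets[OF increment_measurable[OF s], of "{k}"]
    by (simp add: vimage_def Int_def conj_commute)
  have G: "g \<in> events \<and> prob (?K \<inter> g) = prob ?K * prob g" if g_in: "g \<in> G" for g
  proof
    obtain C where C: "C \<in> prod_algebra {s'..} ?P" and g: "g = \<Phi> -` C \<inter> space M"
      using g_in by (auto simp: G_def)
    have "C \<in> sets (PiM {s'..} ?P)"
      using C by (simp add: sets_PiM)
    then show "g \<in> events"
      unfolding g by (rule measurable_sets[OF \<Phi>_meas])
    from C obtain J E where C_eq: "C = prod_emb {s'..} ?P J (\<Pi>\<^sub>E j\<in>J. E j)"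
      and J: "finite J" "J \<subseteq> {s'..}"
      by (rule prod_algebraE) blast
    have "restrict (\<Phi> \<omega>) J = (\<lambda>j\<in>J. increment s' j \<omega>)" for \<omega>
      unfolding \<Phi>_def restrict_restrict Int_absorb1[OF J(2)] ..
    then have "\<Phi> \<omega> \<in> C \<longleftrightarrow> (\<forall>j\<in>J. increment s' j \<omega> \<in> E j)" for \<omega>
      unfolding C_eq prod_emb_iff by (simp add: \<Phi>_def restrict_PiE_iff Pi_iff)
    then have "g = {\<omega> \<in> space M. \<forall>j\<in>J. increment s' j \<omega> \<in> E j}"
      unfolding g by blast
    then show "prob (?K \<inter> g) = prob ?K * prob g"
      using indep_increment_cylinder[OF s J] by simp
  qed
  have "Int_stable G"
  proof (rule Int_stableI)
    fix a b assume "a \<in> G" "b \<in> G"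
    then obtain C D where "C \<in> prod_algebra {s'..} ?P" "D \<in> prod_algebra {s'..} ?P"
      and ab: "a = \<Phi> -` C \<inter> space M" "b = \<Phi> -` D \<inter> space M"
      by (auto simp: G_def)
    then have "C \<inter> D \<in> prod_algebra {s'..} ?P"
      using Int_stable_prod_algebra by (auto simp: Int_stable_def)
    moreover have "a \<inter> b = \<Phi> -` (C \<inter> D) \<inter> space M"
      using ab by auto
    ultimately show "a \<inter> b \<in> G"
      unfolding G_def by blast
  qed
  moreover have "indep_set {?K} G"
    unfolding indep_sets2_eq using K G by auto
  moreover have "Int_stable {?K}"
    by (simp add: Int_stable_def)
  ultimately have "indep_set (sigma_sets (space M) {?K}) (sigma_sets (space M) G)"
    by (intro indep_set_sigma_sets)
  moreover have "A \<in> sigma_sets (space M) G"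
  proof -
    \<comment> \<open>Taking preimages commutes with generating a sigma-algebra, so \<open>G\<close>
      generates all of \<open>future s'\<close>.\<close>
    have "sigma_sets (space M) G
        = {\<Phi> -` C \<inter> space M | C. C \<in> sigma_sets ?\<Omega> (prod_algebra {s'..} ?P)}"
      unfolding G_def by (rule sigma_sets_vimage_commute[OF \<Phi>, symmetric])
    also have "\<dots> = sets (future s')"
      unfolding future_def \<Phi>_def[symmetric]
      by (subst sets_vimage_algebra2) (use \<Phi> in \<open>auto simp: space_PiM sets_PiM\<close>)
    finally show ?thesis
      using A by simp
  qed
  ultimately show ?thesis
    by (intro indep_setD) auto
qed

end

section \<open>First-step analysis of the maximum\<close>

text \<open>The difference quotient between two points is squeezed for every pair near
  \<open>r\<close>, but only pairs with \<open>r\<close> as an end point enter the limits; hence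
  one-sided limits of the bounds suffice.\<close>

lemma DERIV_sandwich:
  fixes \<phi> :: "real \<Rightarrow> real"
  assumes "0 < \<delta>"
    and lower: "\<And>x y. r - \<delta> < x \<Longrightarrow> x < y \<Longrightarrow> y < r + \<delta> \<Longrightarrow> l x y * (y - x) \<le> \<phi> y - \<phi> x"
    and upper: "\<And>x y. r - \<delta> < x \<Longrightarrow> x < y \<Longrightarrow> y < r + \<delta> \<Longrightarrow> \<phi> y - \<phi> x \<le> u x y * (y - x)"
    and l: "((\<lambda>y. l r y) \<longlongrightarrow> D) (at_right r)" "((\<lambda>x. l x r) \<longlongrightarrow> D) (at_left r)"
    and u: "((\<lambda>y. u r y) \<longlongrightarrow> D) (at_right r)" "((\<lambda>x. u x r) \<longlongrightarrow> D) (at_left r)"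
  shows "(\<phi> has_field_derivative D) (at r)"
proof -
  have "((\<lambda>y. (\<phi> y - \<phi> r) / (y - r)) \<longlongrightarrow> D) (at_right r)"
  proof (rule tendsto_sandwich[OF _ _ l(1) u(1)])
    have "eventually (\<lambda>y. y \<in> {r<..<r + \<delta>}) (at_right r)"
      using \<open>0 < \<delta>\<close> by (intro eventually_at_right_real) simp
    then show "eventually (\<lambda>y. l r y \<le> (\<phi> y - \<phi> r) / (y - r)) (at_right r)"
      and "eventually (\<lambda>y. (\<phi> y - \<phi> r) / (y - r) \<le> u r y) (at_right r)"
      using lower[of r] upper[of r] \<open>0 < \<delta>\<close>
      by (auto elim!: eventually_mono simp: pos_le_divide_eq pos_divide_le_eq)
  qed
  moreover have "((\<lambda>y. (\<phi> y - \<phi> r) / (y - r)) \<longlongrightarrow> D) (at_left r)"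
  proof (rule tendsto_sandwich[OF _ _ l(2) u(2)])
    have "eventually (\<lambda>x. x \<in> {r - \<delta><..<r}) (at_left r)"
      using \<open>0 < \<delta>\<close> by (intro eventually_at_left_real) simp
    moreover have "(\<phi> x - \<phi> r) / (x - r) = (\<phi> r - \<phi> x) / (r - x)" for x
      by (metis minus_diff_eq minus_divide_divide)
    ultimately show "eventually (\<lambda>y. l y r \<le> (\<phi> y - \<phi> r) / (y - r)) (at_left r)"
      and "eventually (\<lambda>y. (\<phi> y - \<phi> r) / (y - r) \<le> u y r) (at_left r)"
      using lower[of _ r] upper[of _ r] \<open>0 < \<delta>\<close>
      by (auto elim!: eventually_mono simp: pos_le_divide_eq pos_divide_le_eq)
  qed
  ultimately show ?thesis
    unfolding has_field_derivative_iff by (rule filterlim_split_at[rotated])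
qed

context poisson_process
begin

text \<open>Strict exceedance corresponds to half-lines \<open>{b<..}\<close> for the law of the
  maximum; it also makes level 0 certain for an upward start and level \<open>t - s\<close>
  impossible.\<close>

definition tail_event :: "real \<Rightarrow> real \<Rightarrow> real \<Rightarrow> nat \<Rightarrow> real \<Rightarrow> 'a set" where
  "tail_event \<sigma> t s n b = {\<omega> \<in> space M.
     (\<exists>r\<in>{s..t}. b < \<sigma> * parity_displacement (increment s) \<omega> s r) \<and> increment s t \<omega> = n}"

lemma increment_set [measurable]:
  assumes "0 \<le> s" "s \<le> u"
  shows "{\<omega> \<in> space M. increment s u \<omega> = n} \<in> events"
  using measurable_sets[OF increment_measurable[OF assms], of "{n}"]
  by (simp add: vimage_def Int_def conj_commute)

lemma tail_event_future:
  assumes "0 \<le> s" "s \<le> t"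
  shows "tail_event \<sigma> t s n b \<in> sets (future s)"
proof -
  have "{\<omega> \<in> space (future s). increment s t \<omega> = n} \<in> sets (future s)"
    using measurable_sets[OF increment_measurable_future[OF assms(2)], of "{n}"]
    by (simp add: vimage_def Int_def conj_commute)
  moreover have "{\<omega> \<in> space (future s). \<exists>r\<in>{s..t}. b < \<sigma> * parity_displacement (increment s) \<omega> s r}
      \<in> sets (future s)"
    by (rule counting_family.exceeds_measurable[OF counting_family_future[OF assms(1)] _ assms(2)]) simp
  ultimately have "{\<omega> \<in> space (future s).
      (\<exists>r\<in>{s..t}. b < \<sigma> * parity_displacement (increment s) \<omega> s r) \<and> increment s t \<omega> = n} \<in> sets (future s)"
    by (intro sets.sets_Collect_conj)
  then show ?thesis
    by (simp add: tail_event_def)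
qed

lemma tail_event_events:
  assumes "0 \<le> s" "s \<le> t"
  shows "tail_event \<sigma> t s n b \<in> events"
  unfolding tail_event_def using assms
  by (intro sets.sets_Collect_conj increment_set
      counting_family.exceeds_measurable[OF counting_family_increment]) auto

text \<open>Increments add, so signs multiply: after \<open>s'\<close> the path is a restarted one,
  reversed if the number of jumps up to \<open>s'\<close> is odd.\<close>

lemma parity_displacement_shift:
  assumes "\<omega> \<in> space M" "0 \<le> s" "s \<le> s'" "s' \<le> r"
  shows "parity_displacement (increment s) \<omega> s r = parity_displacement (increment s) \<omega> s s'
    + (- 1) ^ increment s s' \<omega> * parity_displacement (increment s') \<omega> s' r"
proof -
  have eq: "(- 1) ^ increment s u \<omega> = (- 1) ^ increment s s' \<omega> * ((- 1) ^ increment s' u \<omega> :: real)"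
    if "s' \<le> u" for u
    by (subst increment_add[OF assms(1-3) that]) (rule power_add)
  have "parity_displacement (increment s) \<omega> s' r
      = (LBINT u:{s'..r}. (- 1) ^ increment s s' \<omega> * (- 1) ^ increment s' u \<omega>)"
    unfolding parity_displacement_def
    by (rule set_lebesgue_integral_cong, simp, intro allI impI eq) simp
  also have "\<dots> = (- 1) ^ increment s s' \<omega> * parity_displacement (increment s') \<omega> s' r"
    unfolding parity_displacement_def by simp
  finally show ?thesis
    using counting_family.parity_displacement_combine
        [OF counting_family_increment[OF assms(2)] assms(1) order_refl assms(3,4)]
    by simp
qed

lemma parity_displacement_no_jump:
  assumes "\<omega> \<in> space M" "0 \<le> s" "s \<le> r" "r \<le> s'" "increment s s' \<omega> = 0"
  shows "parity_displacement (increment s) \<omega> s r = r - s"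
proof -
  have "increment s u \<omega> = 0" if "s \<le> u" "u \<le> r" for u
    using increment_add[of \<omega> s u s'] assms that by simp
  then have "parity_displacement (increment s) \<omega> s r = (LBINT u:{s..r}. 1)"
    unfolding parity_displacement_def by (intro set_lebesgue_integral_cong) auto
  then show ?thesis
    using assms by (simp add: set_lebesgue_integral_def)
qed

lemma abs_parity_displacement_increment_le:
  assumes "\<omega> \<in> space M" "0 \<le> s" "s \<le> r"
  shows "\<bar>parity_displacement (increment s) \<omega> s r\<bar> \<le> r - s"
  by (rule counting_family.abs_parity_displacement_le[OF counting_family_increment]) (use assms in auto)

text \<open>Until \<open>s + h\<close> the path is straight, so an upward path rises by less than
  \<open>h \<le> b\<close> before that time and a downward one never gets above 0. The level can
  only be crossed later, by the restarted path.\<close>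

lemma tail_event_no_jump:
  assumes \<sigma>: "\<sigma> = 1 \<or> \<sigma> = - 1" and s: "0 \<le> s" "0 < h" "s + h \<le> t"
    and b: "0 < b" "\<sigma> = 1 \<Longrightarrow> h \<le> b"
    and \<omega>: "\<omega> \<in> space M" "increment s (s + h) \<omega> = 0"
  shows "\<omega> \<in> tail_event \<sigma> t s n b \<longleftrightarrow> \<omega> \<in> tail_event \<sigma> t (s + h) n (b - \<sigma> * h)"
proof -
  have inc: "increment s t \<omega> = increment (s + h) t \<omega>"
    using increment_add[of \<omega> s "s + h" t] \<omega> s by simp
  have eq: "parity_displacement (increment s) \<omega> s r
      = h + parity_displacement (increment (s + h)) \<omega> (s + h) r" if "s + h \<le> r" for r
    using parity_displacement_shift[of \<omega> s "s + h" r] parity_displacement_no_jump[of \<omega> s "s + h" "s + h"]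
      \<omega> s that by simp
  have ge: "s + h \<le> r" if "s \<le> r" "b < \<sigma> * parity_displacement (increment s) \<omega> s r" for r
  proof (rule ccontr)
    assume "\<not> s + h \<le> r"
    then have "parity_displacement (increment s) \<omega> s r = r - s"
      using that \<omega> s by (intro parity_displacement_no_jump[of _ _ _ "s + h"]) auto
    then show False
      using \<sigma> that b \<open>\<not> s + h \<le> r\<close> by auto
  qed
  show ?thesis
  proof
    assume "\<omega> \<in> tail_event \<sigma> t s n b"
    then obtain r where r: "s \<le> r" "r \<le> t" "increment s t \<omega> = n"
      and br: "b < \<sigma> * parity_displacement (increment s) \<omega> s r"
      by (auto simp: tail_event_def)
    have "s + h \<le> r"
      by (rule ge[OF r(1) br])
    moreover have "b - \<sigma> * h < \<sigma> * parity_displacement (increment (s + h)) \<omega> (s + h) r"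
      using br unfolding eq[OF \<open>s + h \<le> r\<close>] distrib_left by simp
    ultimately show "\<omega> \<in> tail_event \<sigma> t (s + h) n (b - \<sigma> * h)"
      using r inc \<omega>(1) unfolding tail_event_def by auto
  next
    assume "\<omega> \<in> tail_event \<sigma> t (s + h) n (b - \<sigma> * h)"
    then obtain r where r: "s + h \<le> r" "r \<le> t" "increment (s + h) t \<omega> = n"
      and br: "b - \<sigma> * h < \<sigma> * parity_displacement (increment (s + h)) \<omega> (s + h) r"
      by (auto simp: tail_event_def)
    have "b < \<sigma> * parity_displacement (increment s) \<omega> s r"
      using br unfolding eq[OF r(1)] distrib_left by simp
    moreover have "s \<le> r"
      using r(1) s by simp
    ultimately show "\<omega> \<in> tail_event \<sigma> t s n b"
      using r inc \<omega>(1) unfolding tail_event_def by auto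
  qed
qed

text \<open>The jump may sit anywhere in the interval, but the displacement gathered up to
  \<open>s + h\<close> is at most \<open>h\<close> in absolute value. Hence the new level lies
  between \<open>b - h\<close> and \<open>b + h\<close>, one bound being used here and the other in
  the next lemma. The condition \<open>h \<le> b\<close> excludes a crossing before
  \<open>s + h\<close>.\<close>

lemma tail_event_one_jump_upper:
  assumes \<sigma>: "\<sigma> = 1 \<or> \<sigma> = - 1" and s: "0 \<le> s" "0 < h" "s + h \<le> t" and b: "h \<le> b"
    and \<omega>: "increment s (s + h) \<omega> = 1" "\<omega> \<in> tail_event \<sigma> t s (Suc n) b"
  shows "\<omega> \<in> tail_event (- \<sigma>) t (s + h) n (b - h)"
proof -
  from \<omega> obtain r where r: "\<omega> \<in> space M" "s \<le> r" "r \<le> t" "increment s t \<omega> = Suc n"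
    and br: "b < \<sigma> * parity_displacement (increment s) \<omega> s r"
    by (auto simp: tail_event_def)
  have "increment (s + h) t \<omega> = n"
    using increment_add[of \<omega> s "s + h" t] r \<omega> s by simp
  moreover have "s + h \<le> r"
    using abs_parity_displacement_increment_le[OF r(1) s(1) r(2)] br \<sigma> b by auto
  moreover have "b - h < - \<sigma> * parity_displacement (increment (s + h)) \<omega> (s + h) r"
    using abs_parity_displacement_increment_le[OF r(1) s(1), of "s + h"] br \<sigma> s \<omega>
      parity_displacement_shift[of \<omega> s "s + h" r] r(1) \<open>s + h \<le> r\<close> by auto
  ultimately show ?thesis
    using r unfolding tail_event_def by auto
qed

lemma tail_event_one_jump_lower:
  assumes \<sigma>: "\<sigma> = 1 \<or> \<sigma> = - 1" and s: "0 \<le> s" "0 < h" "s + h \<le> t"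
    and \<omega>: "increment s (s + h) \<omega> = 1" "\<omega> \<in> tail_event (- \<sigma>) t (s + h) n (b + h)"
  shows "\<omega> \<in> tail_event \<sigma> t s (Suc n) b"
proof -
  from \<omega> obtain r where r: "\<omega> \<in> space M" "s + h \<le> r" "r \<le> t" "increment (s + h) t \<omega> = n"
    and br: "b + h < - \<sigma> * parity_displacement (increment (s + h)) \<omega> (s + h) r"
    by (auto simp: tail_event_def)
  have "increment s t \<omega> = Suc n"
    using increment_add[of \<omega> s "s + h" t] r \<omega> s by simp
  moreover have "b < \<sigma> * parity_displacement (increment s) \<omega> s r"
    using abs_parity_displacement_increment_le[OF r(1) s(1), of "s + h"] br \<sigma> s \<omega>
      parity_displacement_shift[of \<omega> s "s + h" r] r by auto
  ultimately show ?thesis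
    using r s unfolding tail_event_def by auto
qed

text \<open>Of the two upper bounds, the crude one yields Lipschitz continuity along
  characteristics; the finer one, which isolates two or more jumps, yields the derivative.\<close>

lemma prob_tail_event_split:
  fixes \<sigma> b :: real and n :: nat
  assumes s: "0 \<le> s" "0 < h" "s + h \<le> t"
  defines "K \<equiv> \<lambda>k. {\<omega> \<in> space M. increment s (s + h) \<omega> = k}" and "A \<equiv> tail_event \<sigma> t s n b"
  shows "prob (K 0 \<inter> A) + prob (K 1 \<inter> A) \<le> prob A"
    and "prob A \<le> prob (K 0 \<inter> A) + (1 - prob (K 0))"
    and "prob A \<le> prob (K 0 \<inter> A) + prob (K 1 \<inter> A) + (1 - prob (K 0) - prob (K 1))"
proof -
  have [measurable]: "K k \<in> events" for k
    unfolding K_def using s by (intro increment_set) auto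
  have [measurable]: "A \<in> events"
    unfolding A_def using s by (intro tail_event_events) auto
  have disj: "K 0 \<inter> K 1 = {}"
    by (auto simp: K_def)
  have sum_Un: "prob (K 0 \<union> K 1) = prob (K 0) + prob (K 1)"
    using disj by (intro finite_measure_Union) simp_all
  have sum_Int: "prob (A \<inter> (K 0 \<union> K 1)) = prob (K 0 \<inter> A) + prob (K 1 \<inter> A)"
    using disj by (subst finite_measure_Union[symmetric]) (auto intro!: arg_cong[where f=prob])
  have *: "prob A = prob (A \<inter> B) + prob (A - B)" "prob (A - B) \<le> 1 - prob B" if "B \<in> events" for B
  proof -
    have "prob ((A \<inter> B) \<union> (A - B)) = prob (A \<inter> B) + prob (A - B)"
      using that by (intro finite_measure_Union) auto
    then show "prob A = prob (A \<inter> B) + prob (A - B)"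
      by (simp add: Int_Diff_Un)
    have "prob (A - B) \<le> prob (space M - B)"
      using that sets.sets_into_space[of A M] by (intro finite_measure_mono) auto
    then show "prob (A - B) \<le> 1 - prob B"
      using prob_compl[OF that] by simp
  qed
  show "prob (K 0 \<inter> A) + prob (K 1 \<inter> A) \<le> prob A"
    "prob A \<le> prob (K 0 \<inter> A) + prob (K 1 \<inter> A) + (1 - prob (K 0) - prob (K 1))"
    using *[of "K 0 \<union> K 1"] sum_Un sum_Int measure_nonneg[of M "A - (K 0 \<union> K 1)"] by auto
  show "prob A \<le> prob (K 0 \<inter> A) + (1 - prob (K 0))"
    using *[of "K 0"] by (simp add: Int_commute)
qed

text \<open>The exponential factor makes this quantity constant along characteristics up to the contribution
  of paths with a jump.\<close>

definition scaled_tail :: "real \<Rightarrow> real \<Rightarrow> real \<Rightarrow> nat \<Rightarrow> real \<Rightarrow> real" where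
  "scaled_tail \<sigma> t s n b = exp (rate * (t - s)) * prob (tail_event \<sigma> t s n b)"

lemma prob_no_jump_tail_event:
  assumes \<sigma>: "\<sigma> = 1 \<or> \<sigma> = - 1" and s: "0 \<le> s" "0 < h" "s + h \<le> t"
    and b: "0 < b" "\<sigma> = 1 \<Longrightarrow> h \<le> b"
  shows "exp (rate * (t - s)) * prob ({\<omega> \<in> space M. increment s (s + h) \<omega> = 0} \<inter> tail_event \<sigma> t s n b)
    = scaled_tail \<sigma> t (s + h) n (b - \<sigma> * h)"
proof -
  let ?K = "{\<omega> \<in> space M. increment s (s + h) \<omega> = 0}"
  have "?K \<inter> tail_event \<sigma> t s n b = ?K \<inter> tail_event \<sigma> t (s + h) n (b - \<sigma> * h)"
    using tail_event_no_jump[OF \<sigma> s b] by auto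
  also have "prob \<dots> = prob ?K * prob (tail_event \<sigma> t (s + h) n (b - \<sigma> * h))"
    using s by (intro indep_increment_future tail_event_future) auto
  also have "prob ?K = exp (- (rate * h))"
    using s by (subst prob_increment) auto
  finally show ?thesis
    by (simp add: scaled_tail_def exp_add[symmetric] mult.assoc[symmetric] algebra_simps)
qed

lemma prob_one_jump_tail_event:
  assumes s: "0 \<le> s" "0 < h" "s + h \<le> t"
  shows "exp (rate * (t - s)) * prob ({\<omega> \<in> space M. increment s (s + h) \<omega> = 1} \<inter> tail_event \<sigma> t (s + h) n b)
    = rate * h * scaled_tail \<sigma> t (s + h) n b"
proof -
  let ?K = "{\<omega> \<in> space M. increment s (s + h) \<omega> = 1}"
  have "prob (?K \<inter> tail_event \<sigma> t (s + h) n b) = prob ?K * prob (tail_event \<sigma> t (s + h) n b)"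
    using s by (intro indep_increment_future tail_event_future) auto
  also have "prob ?K = rate * h * exp (- (rate * h))"
    using s by (subst prob_increment) auto
  finally have "exp (rate * (t - s)) * prob (?K \<inter> tail_event \<sigma> t (s + h) n b)
      = rate * h * (exp (rate * (t - s)) * exp (- (rate * h))) * prob (tail_event \<sigma> t (s + h) n b)"
    by simp
  also have "exp (rate * (t - s)) * exp (- (rate * h)) = exp (rate * (t - (s + h)))"
    by (simp add: exp_add[symmetric] algebra_simps)
  finally show ?thesis
    by (simp add: scaled_tail_def)
qed

lemma scaled_tail_step:
  assumes \<sigma>: "\<sigma> = 1 \<or> \<sigma> = - 1" and s: "0 \<le> s" "0 < h" "s + h \<le> t"
    and b: "0 < b" "\<sigma> = 1 \<Longrightarrow> h \<le> b"
  shows "0 \<le> scaled_tail \<sigma> t s n b - scaled_tail \<sigma> t (s + h) n (b - \<sigma> * h)"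
    and "scaled_tail \<sigma> t s n b - scaled_tail \<sigma> t (s + h) n (b - \<sigma> * h) \<le> exp (rate * t) * rate * h"
    and "rate * h * scaled_tail (- \<sigma>) t (s + h) n (b + h)
      \<le> scaled_tail \<sigma> t s (Suc n) b - scaled_tail \<sigma> t (s + h) (Suc n) (b - \<sigma> * h)"
    and "h \<le> b \<Longrightarrow> scaled_tail \<sigma> t s (Suc n) b - scaled_tail \<sigma> t (s + h) (Suc n) (b - \<sigma> * h)
      \<le> rate * h * scaled_tail (- \<sigma>) t (s + h) n (b - h) + exp (rate * t) * (rate * h)\<^sup>2"
proof -
  define K where "K k = {\<omega> \<in> space M. increment s (s + h) \<omega> = k}" for k
  define E where "E = exp (rate * (t - s))"
  have "0 < E" "E \<le> exp (rate * t)"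
    using s rate_pos by (auto simp: E_def)
  have [measurable]: "K k \<in> events" for k
    unfolding K_def using s by (intro increment_set) auto
  have pK: "prob (K 0) = exp (- (rate * h))" "prob (K 1) = rate * h * exp (- (rate * h))"
    using prob_increment[of s "s + h" 0] prob_increment[of s "s + h" 1] s by (simp_all add: K_def)
  define d where "d = rate * h"
  have "0 < d" using s rate_pos by (simp add: d_def)
  have exp_d: "1 - d \<le> exp (- d)"
    using exp_ge_add_one_self[of "- d"] by simp
  have "1 - exp (- d) \<le> d"
    using exp_d by simp
  \<comment> \<open>The left-hand side is the probability of at least two jumps. Multiplying
    \<open>1 - d \<le> exp (- d)\<close> by \<open>1 + d\<close> shows that it is of second
    order.\<close>
  moreover have "1 - exp (- d) - d * exp (- d) \<le> d\<^sup>2"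
  proof -
    have "(1 - d) * (1 + d) \<le> exp (- d) * (1 + d)"
      using exp_d \<open>0 < d\<close> by (intro mult_right_mono) auto
    then show ?thesis by (simp add: algebra_simps power2_eq_square)
  qed
  ultimately have *: "E * (1 - prob (K 0)) \<le> exp (rate * t) * rate * h"
      "E * (1 - prob (K 0) - prob (K 1)) \<le> exp (rate * t) * (rate * h)\<^sup>2"
    unfolding pK d_def[symmetric] mult.assoc
    using \<open>0 < E\<close> \<open>E \<le> exp (rate * t)\<close> \<open>0 < d\<close>
    by (meson mult_mono order_trans mult_left_mono mult_right_mono less_imp_le zero_le_power2)+
  note split = prob_tail_event_split[OF s, folded K_def, where \<sigma> = \<sigma> and b = b]
  note no_jump = prob_no_jump_tail_event[OF \<sigma> s b, folded K_def E_def]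
  note one_jump = prob_one_jump_tail_event[OF s, folded K_def E_def, where \<sigma> = "- \<sigma>"]
  have st: "scaled_tail \<sigma> t s n b = E * prob (tail_event \<sigma> t s n b)" for n
    by (simp add: scaled_tail_def E_def)
  have E_mono: "E * x \<le> E * y" if "x \<le> y" for x y
    using that \<open>0 < E\<close> by simp
  have ev: "K k \<inter> tail_event \<sigma> t s n b \<in> events" for k n
    using s by (intro sets.Int tail_event_events) auto
  have "0 \<le> E * prob (K 1 \<inter> tail_event \<sigma> t s n b)"
    using \<open>0 < E\<close> by simp
  then show "0 \<le> scaled_tail \<sigma> t s n b - scaled_tail \<sigma> t (s + h) n (b - \<sigma> * h)"
    using E_mono[OF split(1)[of n]] no_jump[of n] unfolding st distrib_left by linarith
  show "scaled_tail \<sigma> t s n b - scaled_tail \<sigma> t (s + h) n (b - \<sigma> * h) \<le> exp (rate * t) * rate * h"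
    using E_mono[OF split(2)[of n]] no_jump[of n] * unfolding st distrib_left by linarith
  have "prob (K 1 \<inter> tail_event (- \<sigma>) t (s + h) n (b + h)) \<le> prob (K 1 \<inter> tail_event \<sigma> t s (Suc n) b)"
    using tail_event_one_jump_lower[OF \<sigma> s] ev by (intro finite_measure_mono) (auto simp: K_def)
  from E_mono[OF this] show "rate * h * scaled_tail (- \<sigma>) t (s + h) n (b + h)
      \<le> scaled_tail \<sigma> t s (Suc n) b - scaled_tail \<sigma> t (s + h) (Suc n) (b - \<sigma> * h)"
    using E_mono[OF split(1)[of "Suc n"]] no_jump[of "Suc n"] one_jump
    unfolding st distrib_left by simp
  assume "h \<le> b"
  have "prob (K 1 \<inter> tail_event \<sigma> t s (Suc n) b) \<le> prob (K 1 \<inter> tail_event (- \<sigma>) t (s + h) n (b - h))"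
    using tail_event_one_jump_upper[OF \<sigma> s \<open>h \<le> b\<close>] s
    by (intro finite_measure_mono sets.Int tail_event_events) (auto simp: K_def)
  from E_mono[OF this] show "scaled_tail \<sigma> t s (Suc n) b - scaled_tail \<sigma> t (s + h) (Suc n) (b - \<sigma> * h)
      \<le> rate * h * scaled_tail (- \<sigma>) t (s + h) n (b - h) + exp (rate * t) * (rate * h)\<^sup>2"
    using E_mono[OF split(3)[of "Suc n"]] no_jump[of "Suc n"] one_jump *
    unfolding st distrib_left by simp
qed

lemma scaled_tail_0:
  assumes \<sigma>: "\<sigma> = 1 \<or> \<sigma> = - 1" and s: "0 \<le> s" and b: "0 < b" "b < t - s"
  shows "scaled_tail \<sigma> t s 0 b = tail_poly \<sigma> 0 (t - s) b"
proof -
  have W: "parity_displacement (increment s) \<omega> s r = r - s"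
    if "\<omega> \<in> space M" "increment s t \<omega> = 0" "s \<le> r" "r \<le> t" for \<omega> r
    by (rule parity_displacement_no_jump[OF that(1) s that(3,4,2)])
  show ?thesis
    using \<sigma>
  proof
    assume [simp]: "\<sigma> = 1"
    have "\<exists>r\<in>{s..t}. b < parity_displacement (increment s) \<omega> s r"
      if "\<omega> \<in> space M" "increment s t \<omega> = 0" for \<omega>
      using W[OF that, of t] b s by (intro bexI[of _ t]) auto
    then have "tail_event 1 t s 0 b = {\<omega> \<in> space M. increment s t \<omega> = 0}"
      by (auto simp: tail_event_def)
    moreover have "prob {\<omega> \<in> space M. increment s t \<omega> = 0} = exp (- (rate * (t - s)))"
      using s b by (subst prob_increment) auto
    ultimately show ?thesis
      by (simp add: scaled_tail_def exp_add[symmetric] tail_poly_def bipoly_def tail_weight_def)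
  next
    assume [simp]: "\<sigma> = - 1"
    have "\<not> b < - parity_displacement (increment s) \<omega> s r"
      if "\<omega> \<in> space M" "increment s t \<omega> = 0" "s \<le> r" "r \<le> t" for \<omega> r
      using W[OF that] b that by auto
    then have "tail_event (- 1) t s 0 b = {}"
      by (auto simp: tail_event_def)
    then show ?thesis
      by (simp add: scaled_tail_def tail_poly_def bipoly_def tail_weight_def)
  qed
qed

text \<open>By right continuity some initial interval contains no jump, and there the path
  rises.\<close>

lemma exists_positive_displacement:
  assumes "\<omega> \<in> space M" "0 \<le> s" "s < t"
  shows "\<exists>r\<in>{s..t}. 0 < parity_displacement (increment s) \<omega> s r"
proof -
  have "eventually (\<lambda>r. increment s r \<omega> = increment s s \<omega>) (at_right s)"
    by (intro eventually_at_right_eq_nat increment_right_continuous assms)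
  moreover have "eventually (\<lambda>r. r \<in> {s<..<t}) (at_right s)"
    by (rule eventually_at_right_real[OF assms(3)])
  ultimately have "eventually (\<lambda>r. r \<in> {s<..<t} \<and> increment s r \<omega> = 0) (at_right s)"
    by eventually_elim (auto simp: increment_def)
  then obtain r where "s < r" "r < t" "increment s r \<omega> = 0"
    using eventually_happens'[OF trivial_limit_at_right_real] by force
  then show ?thesis
    using assms parity_displacement_no_jump[of \<omega> s r r] by (intro bexI[of _ r]) auto
qed

text \<open>These are the values at the ends of the characteristics: level 0 imposes no condition
  beyond the number of jumps, and a path of unit speed cannot get above
  \<open>t - s\<close>.\<close>

lemma scaled_tail_boundary:
  assumes "0 \<le> s" "s < t"
  shows "scaled_tail 1 t s n 0 = rate ^ n * tail_poly 1 n (t - s) 0"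
    and "scaled_tail (- 1) t s n (t - s) = rate ^ n * tail_poly (- 1) n (t - s) (t - s)"
proof -
  have "tail_event 1 t s n 0 = {\<omega> \<in> space M. increment s t \<omega> = n}"
    using exists_positive_displacement[OF _ assms] by (auto simp: tail_event_def)
  then show "scaled_tail 1 t s n 0 = rate ^ n * tail_poly 1 n (t - s) 0"
    using assms
    by (simp add: scaled_tail_def prob_increment exp_add[symmetric] tail_poly_diagonal
        power_mult_distrib mult.assoc[symmetric])
  have "tail_event (- 1) t s n (t - s) = {}"
    using abs_parity_displacement_increment_le[OF _ assms(1)] by (fastforce simp: tail_event_def)
  then show "scaled_tail (- 1) t s n (t - s) = rate ^ n * tail_poly (- 1) n (t - s) (t - s)"
    by (simp add: scaled_tail_def tail_poly_edge)
qed

text \<open>The derivative is available only inside the region; continuity up to the closed end of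
  the characteristic is what connects it with the boundary value.\<close>

lemma continuous_on_scaled_tail:
  assumes \<sigma>: "\<sigma> = 1 \<or> \<sigma> = - 1" and s: "0 \<le> s" "s + L \<le> t" and b: "0 < b" "\<sigma> = 1 \<Longrightarrow> L \<le> b"
  shows "continuous_on {0..L} (\<lambda>r. scaled_tail \<sigma> t (s + r) n (b - \<sigma> * r))"
proof -
  let ?\<phi> = "\<lambda>r. scaled_tail \<sigma> t (s + r) n (b - \<sigma> * r)" and ?C = "exp (rate * t) * rate"
  have "0 \<le> ?C"
    using rate_pos by simp
  have step: "\<bar>?\<phi> x - ?\<phi> y\<bar> \<le> ?C * (y - x)" if "0 \<le> x" "x < y" "y \<le> L" for x y
  proof -
    have eq: "s + x + (y - x) = s + y" "b - \<sigma> * x - \<sigma> * (y - x) = b - \<sigma> * y"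
      by (simp_all add: algebra_simps)
    have "0 < b - \<sigma> * x" "\<sigma> = 1 \<Longrightarrow> y - x \<le> b - \<sigma> * x"
      using \<sigma> b that by auto
    moreover have "0 \<le> s + x" "0 < y - x" "s + x + (y - x) \<le> t"
      using s that by auto
    ultimately show ?thesis
      using scaled_tail_step(1,2)[OF \<sigma>, of "s + x" "y - x" t "b - \<sigma> * x" n, unfolded eq]
      by (simp only: abs_of_nonneg)
  qed
  have "?C-lipschitz_on {0..L} ?\<phi>"
  proof (rule lipschitz_onI)
    fix x y assume "x \<in> {0..L}" "y \<in> {0..L}"
    then show "dist (?\<phi> x) (?\<phi> y) \<le> ?C * dist x y"
      using step[of x y] step[of y x] by (cases x y rule: linorder_cases) (auto simp: dist_real_def)
  qed fact
  then show ?thesis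
    by (rule lipschitz_on_continuous_on)
qed

text \<open>The loss between two points of the characteristic comes from paths with exactly one
  jump, up to second order. By \<open>IH\<close> that contribution is an explicit polynomial taken
  at a slightly wrong level, and continuity repairs the level in the limit.\<close>

lemma scaled_tail_deriv:
  assumes \<sigma>: "\<sigma> = 1 \<or> \<sigma> = - 1" and s: "0 \<le> s" and r: "0 < r"
    and b: "0 < b - \<sigma> * r" "b - \<sigma> * r < t - (s + r)"
    and IH: "\<And>s b. 0 \<le> s \<Longrightarrow> 0 < b \<Longrightarrow> b < t - s \<Longrightarrow>
      scaled_tail (- \<sigma>) t s n b = rate ^ n * tail_poly (- \<sigma>) n (t - s) b"
  shows "((\<lambda>r. scaled_tail \<sigma> t (s + r) (Suc n) (b - \<sigma> * r)) has_field_derivative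
    - (rate ^ Suc n * tail_poly (- \<sigma>) n (t - (s + r)) (b - \<sigma> * r))) (at r)"
proof -
  define \<phi> where "\<phi> r = scaled_tail \<sigma> t (s + r) (Suc n) (b - \<sigma> * r)" for r
  \<comment> \<open>The perturbed levels must stay where \<open>IH\<close> holds. Against the upper
    edge they lose at most \<delta> through \<open>x\<close>, twice \<delta> through
    \<open>y - x\<close> and \<delta> through \<open>y\<close>, which explains the quarter; \<delta>
    at most \<open>r\<close> keeps \<open>s + x\<close> nonnegative.\<close>
  define \<delta> where "\<delta> = Min {r, (b - \<sigma> * r) / 4, (t - (s + r) - (b - \<sigma> * r)) / 4}"
  have \<delta>: "0 < \<delta>" "\<delta> \<le> r" "4 * \<delta> \<le> b - \<sigma> * r" "4 * \<delta> \<le> t - (s + r) - (b - \<sigma> * r)"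
    using r b by (auto simp: \<delta>_def min_def)
  define C where "C = exp (rate * t) * rate\<^sup>2"
  define G where "G y z = rate ^ Suc n * tail_poly (- \<sigma>) n (t - (s + y)) z" for y z
  \<comment> \<open>The signs are reversed because \<phi> decreases: an upper bound for the loss is
    a lower bound for the difference. The term with \<open>C\<close> is the two-jump error divided
    by the step length.\<close>
  let ?l = "\<lambda>x y. - G y (b - \<sigma> * x - (y - x)) - C * (y - x)"
  let ?u = "\<lambda>x y. - G y (b - \<sigma> * x + (y - x))"
  have "(\<phi> has_field_derivative - G r (b - \<sigma> * r)) (at r)"
  proof (rule DERIV_sandwich[of \<delta> _ ?l _ ?u])
    fix x y assume xy: "r - \<delta> < x" "x < y" "y < r + \<delta>"
    have "0 \<le> s + x" "0 < y - x"
      using xy \<delta> s by auto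
    have dom: "0 < b - \<sigma> * x - (y - x)" "b - \<sigma> * x + (y - x) < t - (s + y)"
      using \<sigma> \<delta> xy by auto
    have b': "0 < b - \<sigma> * x" "s + x + (y - x) \<le> t" "y - x \<le> b - \<sigma> * x"
      using dom \<open>0 < y - x\<close> by auto
    have "s + x + (y - x) = s + y" "b - \<sigma> * x - \<sigma> * (y - x) = b - \<sigma> * y"
      by (simp_all add: algebra_simps)
    note step' = scaled_tail_step(3)[OF \<sigma> \<open>0 \<le> s + x\<close> \<open>0 < y - x\<close> b'(2,1,3), of n, unfolded this]
      scaled_tail_step(4)[OF \<sigma> \<open>0 \<le> s + x\<close> \<open>0 < y - x\<close> b'(2,1,3,3), of n, unfolded this]
    have G: "rate * h * scaled_tail (- \<sigma>) t (s + y) n z = G y z * h"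
      if "0 < z" "z < t - (s + y)" for z h
      using IH[of "s + y" z] that \<open>0 \<le> s + x\<close> \<open>0 < y - x\<close> by (simp add: G_def)
    have "?l x y * (y - x) = - (G y (b - \<sigma> * x - (y - x)) * (y - x) + exp (rate * t) * (rate * (y - x))\<^sup>2)"
      by (simp add: C_def algebra_simps power2_eq_square)
    also have "\<dots> \<le> \<phi> y - \<phi> x"
      using step'(2) G[of "b - \<sigma> * x - (y - x)" "y - x"] dom \<open>0 < y - x\<close> by (simp add: \<phi>_def)
    finally show "?l x y * (y - x) \<le> \<phi> y - \<phi> x" .
    show "\<phi> y - \<phi> x \<le> ?u x y * (y - x)"
      using step'(1) G[of "b - \<sigma> * x + (y - x)" "y - x"] dom \<open>0 < y - x\<close> by (simp add: \<phi>_def)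
  next
    have "isCont (\<lambda>y. ?l r y) r" "isCont (\<lambda>y. ?u r y) r" "isCont (\<lambda>x. ?l x r) r" "isCont (\<lambda>x. ?u x r) r"
      unfolding G_def by (auto intro!: continuous_intros)
    then show "((\<lambda>y. ?l r y) \<longlongrightarrow> - G r (b - \<sigma> * r)) (at_right r)"
      "((\<lambda>x. ?l x r) \<longlongrightarrow> - G r (b - \<sigma> * r)) (at_left r)"
      "((\<lambda>y. ?u r y) \<longlongrightarrow> - G r (b - \<sigma> * r)) (at_right r)"
      "((\<lambda>x. ?u x r) \<longlongrightarrow> - G r (b - \<sigma> * r)) (at_left r)"
      unfolding isCont_def filterlim_at_split by simp_all
  qed (rule \<delta>)
  then show ?thesis
    unfolding \<phi>_def G_def .
qed

text \<open>Along a characteristic both sides have the same derivative, and they agree at its end.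
  The direction is generalised because the induction hypothesis is needed for
  \<open>- \<sigma>\<close>.\<close>

lemma scaled_tail_eq:
  assumes "\<sigma> = 1 \<or> \<sigma> = - 1" "0 \<le> s" "0 < b" "b < t - s"
  shows "scaled_tail \<sigma> t s n b = rate ^ n * tail_poly \<sigma> n (t - s) b"
  using assms
proof (induction n arbitrary: \<sigma> s b)
  case 0
  then show ?case by (simp add: scaled_tail_0)
next
  case (Suc n)
  \<comment> \<open>\<open>L\<close> is the time at which the characteristic leaves the region:
    upward when \<open>b - r = 0\<close>, downward when \<open>b + r = t - s - r\<close>.\<close>
  define L where "L = (if \<sigma> = 1 then b else (t - s - b) / 2)"
  have L: "0 < L" "s + L < t" "\<sigma> = 1 \<Longrightarrow> L \<le> b"
    using Suc.prems by (auto simp: L_def field_simps)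
  define \<psi> where "\<psi> r = scaled_tail \<sigma> t (s + r) (Suc n) (b - \<sigma> * r)
    - rate ^ Suc n * tail_poly \<sigma> (Suc n) (t - s - r) (b - \<sigma> * r)" for r
  have tail_deriv: "((\<lambda>r. tail_poly \<sigma> (Suc n) (t - s - r) (b - \<sigma> * r)) has_field_derivative
      - tail_poly (- \<sigma>) n (t - s - r) (b - \<sigma> * r)) (at r)" for r
    by (rule tail_poly_characteristic[OF Suc.prems(1)])
  have "\<psi> L = \<psi> 0"
  proof (rule DERIV_isconst_end[OF \<open>0 < L\<close>])
    show "continuous_on {0..L} \<psi>"
      unfolding \<psi>_def using Suc.prems L
      by (intro continuous_on_diff continuous_on_mult continuous_on_const continuous_on_scaled_tail
          DERIV_continuous_on[OF has_field_derivative_at_within[OF tail_deriv]]) auto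
    fix r assume r: "0 < r" "r < L"
    have "0 < b - \<sigma> * r" "b - \<sigma> * r < t - (s + r)"
      using r Suc.prems by (auto simp: L_def split: if_splits)
    then have "((\<lambda>r. scaled_tail \<sigma> t (s + r) (Suc n) (b - \<sigma> * r)) has_field_derivative
        - (rate ^ Suc n * tail_poly (- \<sigma>) n (t - (s + r)) (b - \<sigma> * r))) (at r)"
      using Suc.prems r by (intro scaled_tail_deriv Suc.IH) auto
    from DERIV_diff[OF this DERIV_cmult[OF tail_deriv, of "rate ^ Suc n"]]
    show "(\<psi> has_field_derivative 0) (at r)"
      unfolding \<psi>_def by (simp add: diff_diff_eq)
  qed
  also have "\<psi> L = 0"
    using Suc.prems(1)
  proof
    assume "\<sigma> = 1"
    then show ?thesis
      using scaled_tail_boundary(1)[of "s + L" t "Suc n"] Suc.prems(2) L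
      by (simp add: \<psi>_def L_def diff_diff_eq)
  next
    assume "\<sigma> = - 1"
    then have edge: "b - \<sigma> * L = t - (s + L)"
      by (simp add: L_def field_simps)
    show ?thesis
      using scaled_tail_boundary(2)[of "s + L" t "Suc n"] Suc.prems(2) L \<open>\<sigma> = - 1\<close>
      unfolding \<psi>_def edge diff_diff_eq by simp
  qed
  finally show ?case
    by (simp add: \<psi>_def)
qed

end

section \<open>Densities from tails and series\<close>

text \<open>The tail is known only inside \<open>{0<..<d}\<close>, since atoms at the ends are
  possible. So the measures are compared on half-open intervals within it, which then exhaust
  it.\<close>

lemma emeasure_eq_density_of_tail_deriv:
  fixes \<mu> :: "real measure"
  assumes "finite_measure \<mu>" and sets_\<mu>: "sets \<mu> = sets borel"
    and tail: "\<And>x. 0 < x \<Longrightarrow> x < d \<Longrightarrow> emeasure \<mu> {x<..} = ennreal (F x)"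
    and F_nonneg: "\<And>x. 0 < x \<Longrightarrow> x < d \<Longrightarrow> 0 \<le> F x"
    and F_deriv: "\<And>x. 0 < x \<Longrightarrow> x < d \<Longrightarrow> (F has_field_derivative - f x) (at x)"
    and f_meas [measurable]: "f \<in> borel_measurable borel"
    and f_nonneg: "\<And>x. 0 < x \<Longrightarrow> x < d \<Longrightarrow> 0 \<le> f x"
    and B: "B \<in> sets borel" "B \<subseteq> {0<..<d}"
  shows "emeasure \<mu> B = emeasure (density lborel (\<lambda>x. ennreal (f x))) B"
proof -
  interpret finite_measure \<mu> by fact
  have [measurable_cong, simp]: "sets \<mu> = sets borel" by fact
  let ?\<nu> = "density lborel (\<lambda>x. ennreal (f x))"
  have Ioc: "emeasure \<mu> {y<..b} = emeasure ?\<nu> {y<..b}" if "0 < y" "y < b" "b < d" for y b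
  proof -
    have "{y<..b} = {y<..} - {b<..}" by auto
    then have "emeasure \<mu> {y<..b} = emeasure \<mu> {y<..} - emeasure \<mu> {b<..}"
      using that by (simp, subst emeasure_Diff) auto
    also have "\<dots> = ennreal (F y - F b)"
      using that by (simp add: tail ennreal_minus F_nonneg)
    also have "F y - F b = (\<lambda>x. - F x) b - (\<lambda>x. - F x) y"
      by simp
    also have "ennreal \<dots> = (\<integral>\<^sup>+x. ennreal (f x * indicator {y..b} x) \<partial>lborel)"
    proof -
      \<comment> \<open>The sign of \<open>f\<close> is known only on \<open>{0<..<d}\<close>; the
        positive part is nonnegative everywhere and agrees with \<open>f\<close> on
        \<open>{y..b}\<close>.\<close>
      have "(\<integral>\<^sup>+x. ennreal (max 0 (f x)) * indicator {y..b} x \<partial>lborel) = ennreal (- F b - - F y)"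
        using that f_nonneg
        by (intro nn_integral_FTC_Icc) (auto intro!: derivative_eq_intros F_deriv)
      also have "(\<integral>\<^sup>+x. ennreal (max 0 (f x)) * indicator {y..b} x \<partial>lborel)
          = (\<integral>\<^sup>+x. ennreal (f x * indicator {y..b} x) \<partial>lborel)"
        using that f_nonneg by (intro nn_integral_cong) (auto simp: indicator_def)
      finally show ?thesis by simp
    qed
    also have "\<dots> = (\<integral>\<^sup>+x. ennreal (f x) * indicator {y<..b} x \<partial>lborel)"
      using AE_lborel_singleton[of y]
      by (intro nn_integral_cong_AE, eventually_elim) (auto simp: indicator_def)
    also have "\<dots> = emeasure ?\<nu> {y<..b}"
      by (subst emeasure_density) auto
    finally show ?thesis .
  qed
  \<comment> \<open>After restriction to \<open>{a<..b}\<close> both measures are determined by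
    half-lines, which meet it in an interval with left end \<open>max a x > 0\<close> or not at
    all.\<close>
  have restricted: "emeasure \<mu> ({a<..b} \<inter> B) = emeasure ?\<nu> ({a<..b} \<inter> B)"
    if ab: "0 < a" "a < b" "b < d" and "B \<in> sets borel" for a b B
  proof -
    have *: "{a<..b} \<inter> {x<..} = (if x < b then {max a x<..b} else {})" for x by auto
    have "density \<mu> (indicator {a<..b}) = density ?\<nu> (indicator {a<..b})"
    proof (rule measure_eqI_lessThan)
      fix x
      show "emeasure (density \<mu> (indicator {a<..b})) {x<..} < \<infinity>"
        by (subst emeasure_restricted) (auto simp: less_top[symmetric])
      show "emeasure (density \<mu> (indicator {a<..b})) {x<..}
          = emeasure (density ?\<nu> (indicator {a<..b})) {x<..}"
        using ab by (subst (1 2) emeasure_restricted) (auto simp: * Ioc)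
    qed simp_all
    then have "emeasure (density \<mu> (indicator {a<..b})) B = emeasure (density ?\<nu> (indicator {a<..b})) B"
      by simp
    then show ?thesis
      using \<open>B \<in> sets borel\<close> by (subst (asm) (1 2) emeasure_restricted) auto
  qed
  show ?thesis
  proof (cases "0 < d")
    case False
    then have "B = {}" using B by auto
    then show ?thesis by simp
  next
    case True
    \<comment> \<open>The summand 3 makes the left end smaller than the right one already for
      \<open>m = 0\<close>.\<close>
    define I where "I m = {d / (real m + 3)<..d - d / (real m + 3)}" for m :: nat
    have anti: "d / (real m + 3) \<le> d / (real k + 3)" if "k \<le> m" for k m :: nat
      using True that by (intro divide_left_mono) auto
    have I_inc: "incseq (\<lambda>m. I m \<inter> B)"
      unfolding incseq_def I_def
    proof (intro allI impI Int_mono order_refl subsetI)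
      fix m k :: nat and x
      assume "m \<le> k" "x \<in> {d / (real m + 3)<..d - d / (real m + 3)}"
      then show "x \<in> {d / (real k + 3)<..d - d / (real k + 3)}"
        using anti[OF \<open>m \<le> k\<close>] by auto
    qed
    have "x \<in> (\<Union>m. I m \<inter> B)" if "x \<in> B" for x
    proof -
      have "0 < x" "x < d" using B that by auto
      then have "0 < min x (d - x)" by simp
      then obtain m :: nat where "d / min x (d - x) < real m"
        using reals_Archimedean2 by blast
      then have "d < real m * min x (d - x)"
        using \<open>0 < min x (d - x)\<close> by (simp add: pos_divide_less_eq)
      also have "\<dots> \<le> (real m + 3) * min x (d - x)"
        using \<open>0 < min x (d - x)\<close> by (intro mult_right_mono) auto
      finally have "d < min x (d - x) * (real m + 3)"
        by (simp only: mult.commute)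
      then have "d / (real m + 3) < min x (d - x)"
        by (intro pos_divide_less_eq[THEN iffD2]) simp_all
      then show ?thesis
        using that by (auto simp: I_def)
    qed
    then have B_eq: "(\<Union>m. I m \<inter> B) = B" by auto
    have "emeasure \<mu> (I m \<inter> B) = emeasure ?\<nu> (I m \<inter> B)" for m
      unfolding I_def
    proof (rule restricted)
      have "d / (real m + 3) \<le> d / 3"
        using True by (intro divide_left_mono) auto
      then show "d / (real m + 3) < d - d / (real m + 3)"
        using True by linarith
    qed (use True B in auto)
    moreover have "(SUP m. emeasure L (I m \<inter> B)) = emeasure L B" if "sets L = sets borel" for L
    proof -
      have "I m \<inter> B \<in> sets L" for m
        unfolding that I_def by (rule sets.Int[OF _ B(1)]) simp
      then have "range (\<lambda>m. I m \<inter> B) \<subseteq> sets L"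
        by blast
      from SUP_emeasure_incseq[OF this I_inc] show ?thesis
        unfolding B_eq .
    qed
    note this[of \<mu>] this[of ?\<nu>]
    ultimately show ?thesis by simp
  qed
qed

section \<open>Countable sums of densities\<close>

locale density_series = finite_measure \<mu> for \<mu> :: "real measure" +
  fixes S :: "real set" and f :: "nat \<Rightarrow> real \<Rightarrow> real" and g :: "real \<Rightarrow> real"
  assumes sets_eq [measurable_cong, simp]: "sets \<mu> = sets borel"
    and S [measurable]: "S \<in> sets borel"
    and f_measurable [measurable]: "\<And>k. f k \<in> borel_measurable borel"
    and f_nonneg: "\<And>k x. x \<in> S \<Longrightarrow> 0 \<le> f k x"
    and f_sums: "\<And>x. x \<in> S \<Longrightarrow> (\<lambda>k. f k x) sums g x"
    and emeasure_series: "\<And>B. B \<in> sets borel \<Longrightarrow> B \<subseteq> S \<Longrightarrow>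
      emeasure \<mu> B = (\<Sum>k. emeasure (density lborel (\<lambda>x. ennreal (f k x))) B)"
begin

lemma density_measurable [measurable]: "(\<lambda>x. indicator S x * g x) \<in> borel_measurable borel"
proof -
  have "(\<lambda>k. indicator S x * f k x) sums (indicator S x * g x)" for x
    using f_sums[of x] by (cases "x \<in> S") auto
  then have "indicator S x * g x = (\<Sum>k. indicator S x * f k x)" for x
    by (rule sums_unique)
  then show ?thesis
    by simp
qed

lemma density_nonneg: "0 \<le> indicator S x * g x"
proof (cases "x \<in> S")
  case True
  then have "0 \<le> (\<Sum>k. f k x)"
    using f_sums[of x] f_nonneg[of x] by (intro suminf_nonneg) (auto simp: sums_iff)
  then show ?thesis
    using True f_sums[of x] by (simp add: sums_iff)
qed simp

text \<open>Monotone convergence exchanges the sum with the integral. The indicator is kept because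
  \<open>g\<close> is controlled on \<open>S\<close> only.\<close>

lemma restricted_eq_density: "density \<mu> (\<lambda>x. ennreal (indicator S x)) = density lborel (\<lambda>x. ennreal (indicator S x * g x))"
proof (rule measure_eqI)
  fix B assume "B \<in> sets (density \<mu> (\<lambda>x. ennreal (indicator S x)))"
  then have [measurable]: "B \<in> sets borel" by simp
  have "(\<lambda>x. ennreal (indicator S x)) = indicator S"
    by (auto simp: indicator_def)
  then have "emeasure (density \<mu> (\<lambda>x. ennreal (indicator S x))) B = emeasure \<mu> (S \<inter> B)"
    by (simp add: emeasure_restricted)
  also have "\<dots> = (\<Sum>k. emeasure (density lborel (\<lambda>x. ennreal (f k x))) (S \<inter> B))"
    by (rule emeasure_series) auto
  also have "\<dots> = (\<Sum>k. \<integral>\<^sup>+x. ennreal (f k x) * indicator (S \<inter> B) x \<partial>lborel)"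
    by (intro suminf_cong emeasure_density) auto
  also have "\<dots> = (\<integral>\<^sup>+x. (\<Sum>k. ennreal (f k x) * indicator (S \<inter> B) x) \<partial>lborel)"
    by (rule nn_integral_suminf[symmetric]) auto
  also have "\<dots> = (\<integral>\<^sup>+x. ennreal (indicator S x * g x) * indicator B x \<partial>lborel)"
  proof (rule nn_integral_cong)
    fix x :: real
    show "(\<Sum>k. ennreal (f k x) * indicator (S \<inter> B) x) = ennreal (indicator S x * g x) * indicator B x"
      using suminf_ennreal_eq[OF f_nonneg f_sums, of x]
      by (cases "x \<in> S"; cases "x \<in> B") auto
  qed
  also have "\<dots> = emeasure (density lborel (\<lambda>x. ennreal (indicator S x * g x))) B"
    by (subst emeasure_density) auto
  finally show "emeasure (density \<mu> (\<lambda>x. ennreal (indicator S x))) B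
      = emeasure (density lborel (\<lambda>x. ennreal (indicator S x * g x))) B" .
qed simp

lemma set_integral_eq:
  fixes h :: "real \<Rightarrow> real"
  assumes [measurable]: "h \<in> borel_measurable borel" "B \<in> sets borel" and "B \<subseteq> S"
  shows "(LINT x:B|\<mu>. h x) = (LBINT x:B. h x * g x)"
proof -
  have "(LINT x:B|\<mu>. h x) = (\<integral>x. indicator S x *\<^sub>R (indicator B x *\<^sub>R h x) \<partial>\<mu>)"
    unfolding set_lebesgue_integral_def using \<open>B \<subseteq> S\<close>
    by (intro Bochner_Integration.integral_cong) (auto simp: indicator_def)
  also have "\<dots> = (\<integral>x. indicator B x *\<^sub>R h x \<partial>density \<mu> (\<lambda>x. ennreal (indicator S x)))"
    by (subst integral_density) auto
  also have "\<dots> = (\<integral>x. indicator B x *\<^sub>R h x \<partial>density lborel (\<lambda>x. ennreal (indicator S x * g x)))"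
    by (simp only: restricted_eq_density)
  also have "\<dots> = (\<integral>x. (indicator S x * g x) *\<^sub>R (indicator B x *\<^sub>R h x) \<partial>lborel)"
    by (rule integral_density) (use density_nonneg in auto)
  also have "\<dots> = (LBINT x:B. h x * g x)"
    unfolding set_lebesgue_integral_def using \<open>B \<subseteq> S\<close>
    by (intro Bochner_Integration.integral_cong) (auto simp: indicator_def)
  finally show ?thesis .
qed

text \<open>The integral of the density is the mass of \<open>S\<close>, which is finite.\<close>

lemma density_set_integrable: "set_integrable lborel S g"
proof -
  have "(\<integral>\<^sup>+x. ennreal (indicator S x * g x) \<partial>lborel)
      = emeasure (density lborel (\<lambda>x. ennreal (indicator S x * g x))) UNIV"
    by (subst emeasure_density) auto
  also have "\<dots> = emeasure (density \<mu> (\<lambda>x. ennreal (indicator S x))) UNIV"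
    by (simp only: restricted_eq_density)
  also have "(\<lambda>x. ennreal (indicator S x)) = indicator S"
    by (auto simp: indicator_def)
  also have "emeasure (density \<mu> (indicator S)) UNIV = emeasure \<mu> S"
    by (subst emeasure_restricted) auto
  also have "\<dots> < \<infinity>"
    by (simp add: less_top[symmetric])
  finally show ?thesis
    unfolding set_integrable_def real_scaleR_def
    by (intro integrableI_nonneg) (auto simp: density_nonneg)
qed

lemma has_density: "has_density_on \<mu> S g"
  unfolding has_density_on_def
proof (intro conjI ballI impI density_set_integrable)
  fix B :: "real set" assume B: "B \<in> sets borel" "B \<subseteq> S"
  then have "measure \<mu> B = (LINT x:B|\<mu>. 1)"
    by (simp add: set_lebesgue_integral_def)
  also have "\<dots> = (LBINT x:B. g x)"
    by (subst set_integral_eq) (use B in auto)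
  finally show "measure \<mu> B = (LBINT x:B. g x)" .
qed

lemma set_integrable_mult_density:
  fixes h :: "real \<Rightarrow> real"
  assumes [measurable]: "h \<in> borel_measurable borel" "B \<in> sets borel" and "B \<subseteq> S"
    and h: "\<And>x. x \<in> B \<Longrightarrow> \<bar>h x\<bar> \<le> C"
  shows "set_integrable lborel B (\<lambda>x. h x * g x)"
proof (rule set_integrable_bound)
  show "set_integrable lborel B (\<lambda>x. C * g x)"
    using set_integrable_subset[OF density_set_integrable _ \<open>B \<subseteq> S\<close>]
    by (intro set_integrable_mult_right) simp
  have eq: "(\<lambda>x. indicator B x *\<^sub>R (h x * g x)) = (\<lambda>x. indicator B x * h x * (indicator S x * g x))"
  proof
    fix x show "indicator B x *\<^sub>R (h x * g x) = indicator B x * h x * (indicator S x * g x)"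
      using \<open>B \<subseteq> S\<close> by (cases "x \<in> B") auto
  qed
  show "set_borel_measurable lborel B (\<lambda>x. h x * g x)"
    unfolding set_borel_measurable_def eq by measurable
  have "\<bar>h x\<bar> \<le> \<bar>C\<bar>" if "x \<in> B" for x
    using h[OF that] by simp
  then show "AE x in lborel. x \<in> B \<longrightarrow> norm (h x * g x) \<le> norm (C * g x)"
    by (auto simp: abs_mult intro!: mult_right_mono)
qed

end

section \<open>Bessel functions as power series in the squared argument\<close>

text \<open>This is the Bessel function without its prefactor, in the variable
  \<open>(z / 2)^2\<close>. It converges for all \<open>w\<close>, and the square roots of the final
  formulas do not enter it.\<close>

definition bessel_series :: "nat \<Rightarrow> real \<Rightarrow> real" where
  "bessel_series \<nu> w = (\<Sum>j. w ^ j / (fact j * fact (j + \<nu>)))"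

lemma bessel_series_sums: "(\<lambda>j. w ^ j / (fact j * fact (j + \<nu>))) sums bessel_series \<nu> w"
  unfolding bessel_series_def
proof (rule summable_sums, rule summable_comparison_test)
  show "summable (\<lambda>j. \<bar>w\<bar> ^ j / fact j)"
    using summable_exp_generic[of "\<bar>w\<bar>"] by (simp add: divide_inverse mult.commute)
  have "\<bar>w\<bar> ^ j / (fact j * fact (j + \<nu>)) \<le> \<bar>w\<bar> ^ j / fact j" for j
  proof -
    have "(1 :: real) \<le> fact (j + \<nu>)"
      by (rule fact_ge_1)
    then show ?thesis
      by (intro divide_left_mono) (auto simp: mult_le_cancel_left1)
  qed
  then show "\<exists>N. \<forall>j\<ge>N. norm (w ^ j / (fact j * fact (j + \<nu>))) \<le> \<bar>w\<bar> ^ j / fact j"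
    by (simp add: abs_mult power_abs)
qed

lemma bessel_I_eq_series: "bessel_I \<nu> z = (z / 2) ^ \<nu> * bessel_series \<nu> ((z / 2)\<^sup>2)"
proof -
  have "Gamma (real j + real \<nu> + 1) = fact (j + \<nu>)" for j
    using Gamma_fact[of "j + \<nu>", where 'a = real] by (simp add: add_ac)
  moreover have "(z / 2) ^ (2 * j + \<nu>) = (z / 2) ^ \<nu> * ((z / 2)\<^sup>2) ^ j" for j
    unfolding power_add power_mult by (rule mult.commute)
  ultimately have "bessel_I \<nu> z = (\<Sum>j. (z / 2) ^ \<nu> * (((z / 2)\<^sup>2) ^ j / (fact j * fact (j + \<nu>))))"
    unfolding bessel_I_def by (simp only: times_divide_eq_right)
  also have "\<dots> = (z / 2) ^ \<nu> * bessel_series \<nu> ((z / 2)\<^sup>2)"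
    unfolding bessel_series_def by (intro suminf_mult sums_summable[OF bessel_series_sums])
  finally show ?thesis .
qed

text \<open>The form that the derivative rule for the Bessel function of order 0 takes in this
  variable; termwise, \<open>j + 1\<close> cancels against one of the two factors
  \<open>(j + 1)!\<close>.\<close>

lemma bessel_series_deriv: "(bessel_series 0 has_field_derivative bessel_series 1 w) (at w)"
proof -
  let ?c = "\<lambda>j. 1 / (fact j * fact j) :: real"
  have "summable (\<lambda>j. ?c j * y ^ j)" for y
    using bessel_series_sums[of y 0] by (simp add: sums_iff)
  from termdiffs_strong_converges_everywhere[OF this, of w]
  have "((\<lambda>w. \<Sum>j. ?c j * w ^ j) has_field_derivative (\<Sum>j. diffs ?c j * w ^ j)) (at w)" .
  moreover have "diffs ?c j * w ^ j = w ^ j / (fact j * fact (j + 1))" for j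
    unfolding diffs_def by (simp add: field_simps del: of_nat_Suc)
  ultimately show ?thesis
    by (simp add: bessel_series_def[abs_def])
qed

section \<open>The law of the maximum\<close>

lemma (in prob_space) emeasure_cond_law:
  assumes [measurable]: "X \<in> borel_measurable M" "Measurable.pred M E" "Measurable.pred M A"
    "B \<in> sets borel"
  shows "emeasure (cond_law M X E A) B
    = emeasure (uniform_measure M {\<omega> \<in> space M. A \<omega>}) {\<omega> \<in> space M. X \<omega> \<in> B \<and> E \<omega>}"
proof -
  let ?R = "restrict_space (uniform_measure M {\<omega> \<in> space M. A \<omega>}) {\<omega> \<in> space M. E \<omega>}"
  have X: "X \<in> measurable ?R borel"
    by (rule measurable_restrict_space1) simp
  have "emeasure (cond_law M X E A) B = emeasure ?R (X -` B \<inter> space ?R)"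
    unfolding cond_law_def by (rule emeasure_distr[OF X]) simp
  also have "X -` B \<inter> space ?R = {\<omega> \<in> space M. X \<omega> \<in> B \<and> E \<omega>}"
    by (auto simp: space_restrict_space)
  also have "emeasure ?R \<dots> = emeasure (uniform_measure M {\<omega> \<in> space M. A \<omega>}) {\<omega> \<in> space M. X \<omega> \<in> B \<and> E \<omega>}"
    by (rule emeasure_restrict_space) auto
  finally show ?thesis .
qed

lemma (in prob_space) emeasure_cond_law_Union:
  fixes E :: "'a \<Rightarrow> bool" and F :: "nat \<Rightarrow> 'a \<Rightarrow> bool"
  assumes [measurable]: "X \<in> borel_measurable M" "\<And>k. Measurable.pred M (F k)" "Measurable.pred M A"
    "B \<in> sets borel"
    and E: "\<And>\<omega>. E \<omega> \<longleftrightarrow> (\<exists>k. F k \<omega>)" and disj: "\<And>\<omega> j k. F j \<omega> \<Longrightarrow> F k \<omega> \<Longrightarrow> j = k"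
  shows "emeasure (cond_law M X E A) B = (\<Sum>k. emeasure (cond_law M X (F k) A) B)"
proof -
  have [measurable]: "Measurable.pred M E"
    unfolding E by measurable
  have "(\<Sum>k. emeasure (cond_law M X (F k) A) B)
      = (\<Sum>k. emeasure (uniform_measure M {\<omega> \<in> space M. A \<omega>}) {\<omega> \<in> space M. X \<omega> \<in> B \<and> F k \<omega>})"
    by (intro suminf_cong emeasure_cond_law) measurable
  also have "\<dots> = emeasure (uniform_measure M {\<omega> \<in> space M. A \<omega>}) (\<Union>k. {\<omega> \<in> space M. X \<omega> \<in> B \<and> F k \<omega>})"
    by (intro suminf_emeasure) (auto simp: disjoint_family_on_def dest: disj)
  also have "(\<Union>k. {\<omega> \<in> space M. X \<omega> \<in> B \<and> F k \<omega>}) = {\<omega> \<in> space M. X \<omega> \<in> B \<and> E \<omega>}"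
    by (auto simp: E)
  also have "emeasure (uniform_measure M {\<omega> \<in> space M. A \<omega>}) \<dots> = emeasure (cond_law M X E A) B"
    by (rule emeasure_cond_law[symmetric]) measurable
  finally show ?thesis by simp
qed

lemma (in prob_space) finite_measure_cond_law:
  assumes [measurable]: "X \<in> borel_measurable M" "Measurable.pred M E" "Measurable.pred M A"
    and "prob {\<omega> \<in> space M. A \<omega>} \<noteq> 0"
  shows "finite_measure (cond_law M X E A)"
proof
  interpret U: prob_space "uniform_measure M {\<omega> \<in> space M. A \<omega>}"
    using assms(4) by (intro prob_space_uniform_measure) (auto simp: emeasure_eq_measure)
  have "emeasure (cond_law M X E A) UNIV
      = emeasure (uniform_measure M {\<omega> \<in> space M. A \<omega>}) {\<omega> \<in> space M. X \<omega> \<in> UNIV \<and> E \<omega>}"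
    by (rule emeasure_cond_law) simp_all
  then have "emeasure (cond_law M X E A) UNIV \<noteq> \<infinity>"
    by (metis U.emeasure_finite infinity_ennreal_def)
  moreover have "space (cond_law M X E A) = UNIV"
    by (simp add: cond_law_def)
  ultimately show "emeasure (cond_law M X E A) (space (cond_law M X E A)) \<noteq> \<infinity>"
    by metis
qed

section \<open>Coefficients of the density for a fixed number of jumps\<close>

text \<open>Differentiating in the level subtracts the weights of the two partial derivatives. The
  tail weights form a step function, so the difference survives only at the step; the index
  \<open>n\<close> is one less than the number of jumps.\<close>

definition weight_jump :: "real \<Rightarrow> nat \<Rightarrow> nat \<Rightarrow> real" where
  "weight_jump \<sigma> n j = tail_weight \<sigma> (Suc n) (Suc j) - tail_weight \<sigma> (Suc n) j"

lemma weight_jump_nonneg: "0 \<le> weight_jump \<sigma> n j"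
  by (auto simp: weight_jump_def tail_weight_def Let_def)

lemma weight_jump_odd_pos: "weight_jump 1 (2 * k) = (\<lambda>j. if j = k then 2 else 0)"
  by (rule ext) (auto simp: weight_jump_def tail_weight_def)

lemma weight_jump_even_neg: "weight_jump (- 1) (Suc (2 * k)) = (\<lambda>j. if j = Suc k then 2 else 0)"
  by (rule ext) (auto simp: weight_jump_def tail_weight_def)

text \<open>Here the threshold is attained by an index of weight 1, so the step splits into two
  halves. This is why two Bessel functions occur in the odd case with downward start.\<close>

lemma weight_jump_odd_neg:
  "weight_jump (- 1) (2 * k) = (\<lambda>j. (if j = k then 1 else 0) + (if j = Suc k then 1 else 0))"
  by (rule ext) (auto simp: weight_jump_def tail_weight_def)

lemma bipoly_add_weights: "bipoly (\<lambda>j. v j + w j) n x y = bipoly v n x y + bipoly w n x y"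
  by (simp add: bipoly_def distrib_right add_divide_distrib sum.distrib)

lemma bipoly_single:
  "bipoly (\<lambda>j. if j = k then a else 0) n x y
    = (if k \<le> n then a * (x ^ k / fact k) * (y ^ (n - k) / fact (n - k)) else 0)"
proof -
  have "bipoly (\<lambda>j. if j = k then a else 0) n x y
      = (\<Sum>j\<le>n. if k = j then a * (x ^ k / fact k) * (y ^ (n - k) / fact (n - k)) else 0)"
    unfolding bipoly_def by (intro sum.cong) auto
  also have "\<dots> = (if k \<le> n then a * (x ^ k / fact k) * (y ^ (n - k) / fact (n - k)) else 0)"
    by simp
  finally show ?thesis .
qed

lemma bipoly_nonneg:
  assumes "\<And>j. 0 \<le> w j" "0 \<le> x" "0 \<le> y"
  shows "0 \<le> bipoly w n x y"
  unfolding bipoly_def using assms by (intro sum_nonneg mult_nonneg_nonneg) auto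

context symmetric_telegraph
begin

lemma count_measurable' [measurable]: "0 \<le> t \<Longrightarrow> N t \<in> measurable M (count_space UNIV)"
  by (rule count_measurable)

lemma V0_measurable' [measurable]: "V0 \<in> borel_measurable M"
  by (rule V0_measurable)

lemma increment_0: "\<omega> \<in> space M \<Longrightarrow> increment 0 u \<omega> = N u \<omega>"
  by (simp add: increment_def count_zero)

lemma telegraph_eq:
  assumes "\<omega> \<in> space M"
  shows "telegraph V0 N r \<omega> = V0 \<omega> * parity_displacement (increment 0) \<omega> 0 r"
  using assms by (simp add: telegraph_def parity_displacement_def increment_0)

lemma less_running_max_iff:
  assumes "\<omega> \<in> space M" "0 \<le> t"
  shows "b < running_max (telegraph V0 N) t \<omega>
    \<longleftrightarrow> (\<exists>r\<in>{0..t}. b < V0 \<omega> * parity_displacement (increment 0) \<omega> 0 r)"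
proof -
  have "\<bar>telegraph V0 N r \<omega>\<bar> \<le> \<bar>V0 \<omega>\<bar> * t" if "r \<in> {0..t}" for r
    unfolding telegraph_eq[OF assms(1)] abs_mult
    using abs_parity_displacement_increment_le[OF assms(1) order_refl, of r] that
    by (intro mult_left_mono) auto
  then have "bdd_above ((\<lambda>r. telegraph V0 N r \<omega>) ` {0..t})"
    by (intro bdd_aboveI2[where M = "\<bar>V0 \<omega>\<bar> * t"]) (auto simp: abs_le_iff)
  then show ?thesis
    unfolding running_max_def using assms by (subst less_cSUP_iff) (auto simp: telegraph_eq)
qed

lemma running_max_measurable:
  assumes "0 \<le> t"
  shows "running_max (telegraph V0 N) t \<in> borel_measurable M"
  unfolding borel_measurable_iff_greater
proof
  fix b
  have "{\<omega> \<in> space M. b < running_max (telegraph V0 N) t \<omega>}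
      = {\<omega> \<in> space M. \<exists>r\<in>{0..t}. b < V0 \<omega> * parity_displacement (increment 0) \<omega> 0 r}"
    using less_running_max_iff[OF _ assms] by auto
  also have "\<dots> \<in> events"
    using counting_family.exceeds_measurable[OF counting_family_increment V0_measurable assms] by simp
  finally show "{\<omega> \<in> space M. b < running_max (telegraph V0 N) t \<omega>} \<in> events" .
qed

lemma prob_V0:
  assumes "\<sigma> = 1 \<or> \<sigma> = - 1"
  shows "prob {\<omega> \<in> space M. V0 \<omega> = \<sigma> * c} = 1 / 2"
  using assms prob_V0_pos prob_V0_neg by auto

lemma prob_V0_tail_event:
  assumes \<sigma>: "\<sigma> = 1 \<or> \<sigma> = - 1" and "0 \<le> t"
  shows "prob ({\<omega> \<in> space M. V0 \<omega> = \<sigma> * c} \<inter> tail_event \<sigma> t 0 n b) = prob (tail_event \<sigma> t 0 n b) / 2"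
proof -
  have "V0 -` {\<sigma> * c} \<inter> space M \<in> sets (vimage_algebra (space M) V0 borel)"
    by (rule in_vimage_algebra) simp
  moreover have "V0 -` {\<sigma> * c} \<inter> space M = {\<omega> \<in> space M. V0 \<omega> = \<sigma> * c}"
    by auto
  moreover have "tail_event \<sigma> t 0 n b \<in> sets (vimage_algebra (space M) (\<lambda>\<omega>. \<lambda>t\<in>{0..}. N t \<omega>)
      (PiM {0..} (\<lambda>_. count_space UNIV)))"
  proof -
    \<comment> \<open>As the count starts at 0, increments from time 0 are the counts themselves,
      and the assumed independence of \<open>V0\<close> concerns exactly
      \<open>future 0\<close>.\<close>
    have "future 0 = vimage_algebra (space M) (\<lambda>\<omega>. \<lambda>t\<in>{0..}. N t \<omega>) (PiM {0..} (\<lambda>_. count_space UNIV))"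
      unfolding future_def by (intro vimage_algebra_cong) (auto simp: increment_0)
    then show ?thesis
      using tail_event_future[OF order_refl assms(2)] by simp
  qed
  ultimately show ?thesis
    using indep_setD[OF indep_V0_N] prob_V0[OF \<sigma>] by simp
qed

abbreviation jump_law :: "real \<Rightarrow> real \<Rightarrow> nat \<Rightarrow> real measure" where
  "jump_law t \<sigma> n \<equiv> cond_law M (running_max (telegraph V0 N) t) (\<lambda>\<omega>. N t \<omega> = n) (\<lambda>\<omega>. V0 \<omega> = \<sigma> * c)"

definition jump_tail :: "real \<Rightarrow> real \<Rightarrow> nat \<Rightarrow> real \<Rightarrow> real" where
  "jump_tail t \<sigma> n \<beta> = exp (- rate * t) * rate ^ n * tail_poly \<sigma> n t (\<beta> / c)"

lemma jump_law_tail: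
  assumes \<sigma>: "\<sigma> = 1 \<or> \<sigma> = - 1" and "0 < t" and \<beta>: "0 < \<beta>" "\<beta> < c * t"
  shows "emeasure (jump_law t \<sigma> n) {\<beta><..} = ennreal (jump_tail t \<sigma> n \<beta>)" and "0 \<le> jump_tail t \<sigma> n \<beta>"
proof -
  have [measurable]: "running_max (telegraph V0 N) t \<in> borel_measurable M"
    using \<open>0 < t\<close> by (intro running_max_measurable) simp
  have [measurable]: "N t \<in> measurable M (count_space UNIV)"
    using \<open>0 < t\<close> by simp
  let ?V = "{\<omega> \<in> space M. V0 \<omega> = \<sigma> * c}"
  interpret L: finite_measure "jump_law t \<sigma> n"
    using prob_V0[OF \<sigma>] by (intro finite_measure_cond_law) auto
  have "\<beta> < \<sigma> * c * x \<longleftrightarrow> \<beta> / c < \<sigma> * x" for x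
    using speed_pos by (simp add: pos_divide_less_eq mult_ac)
  then have "\<beta> < running_max (telegraph V0 N) t \<omega>
      \<longleftrightarrow> (\<exists>r\<in>{0..t}. \<beta> / c < \<sigma> * parity_displacement (increment 0) \<omega> 0 r)"
    if "\<omega> \<in> space M" "V0 \<omega> = \<sigma> * c" for \<omega>
    using less_running_max_iff[OF that(1), of t \<beta>] \<open>0 < t\<close> by (simp only: that(2) less_imp_le)
  then have event: "{\<omega> \<in> space M. (running_max (telegraph V0 N) t \<omega> \<in> {\<beta><..} \<and> N t \<omega> = n) \<and> V0 \<omega> = \<sigma> * c}
      = ?V \<inter> tail_event \<sigma> t 0 n (\<beta> / c)"
    by (auto simp: tail_event_def increment_0)
  have "measure (jump_law t \<sigma> n) {\<beta><..}
      = \<P>(\<omega> in M. running_max (telegraph V0 N) t \<omega> \<in> {\<beta><..} \<and> N t \<omega> = n \<bar> V0 \<omega> = \<sigma> * c)"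
    by (rule measure_cond_law) measurable
  also have "\<dots> = prob (tail_event \<sigma> t 0 n (\<beta> / c))"
    unfolding cond_prob_def event prob_V0[OF \<sigma>] prob_V0_tail_event[OF \<sigma> less_imp_le[OF \<open>0 < t\<close>]]
    by simp
  also have "\<dots> = jump_tail t \<sigma> n \<beta>"
  proof -
    have "\<beta> / c < t - 0"
      using \<beta> speed_pos by (simp add: pos_divide_less_eq mult.commute)
    then have "scaled_tail \<sigma> t 0 n (\<beta> / c) = rate ^ n * tail_poly \<sigma> n (t - 0) (\<beta> / c)"
      using \<beta> speed_pos by (intro scaled_tail_eq \<sigma>) auto
    then have "exp (- rate * t) * (exp (rate * t) * prob (tail_event \<sigma> t 0 n (\<beta> / c))) = jump_tail t \<sigma> n \<beta>"
      by (simp add: scaled_tail_def jump_tail_def)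
    then show ?thesis
      by (simp add: mult.assoc[symmetric] exp_add[symmetric])
  qed
  finally have *: "measure (jump_law t \<sigma> n) {\<beta><..} = jump_tail t \<sigma> n \<beta>" .
  then show "emeasure (jump_law t \<sigma> n) {\<beta><..} = ennreal (jump_tail t \<sigma> n \<beta>)"
    by (simp add: L.emeasure_eq_measure)
  \<comment> \<open>No estimate of the polynomial is needed: it equals a probability.\<close>
  show "0 \<le> jump_tail t \<sigma> n \<beta>"
    unfolding *[symmetric] by simp
qed

text \<open>Without jumps the maximum is 0 or \<open>c * t\<close>, outside the open interval, hence
  the value 0. The factor \<open>1 / (2 * c)\<close> is the rate at which the light-cone coordinates
  change with \<beta>.\<close>

definition jump_density :: "real \<Rightarrow> real \<Rightarrow> nat \<Rightarrow> real \<Rightarrow> real" where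
  "jump_density t \<sigma> n \<beta> = (case n of 0 \<Rightarrow> 0 | Suc m \<Rightarrow>
     exp (- rate * t) * rate ^ n / (2 * c)
       * bipoly (weight_jump \<sigma> m) m ((t - \<beta> / c) / 2) ((t + \<beta> / c) / 2))"

lemma jump_density_measurable [measurable]: "jump_density t \<sigma> n \<in> borel_measurable borel"
  unfolding jump_density_def[abs_def] bipoly_def by (cases n) auto

lemma jump_tail_deriv: "(jump_tail t \<sigma> n has_field_derivative - jump_density t \<sigma> n \<beta>) (at \<beta>)"
proof (cases n)
  case 0
  then show ?thesis
    by (simp add: jump_tail_def[abs_def] jump_density_def tail_poly_def bipoly_def)
next
  case (Suc m)
  let ?x = "\<lambda>\<beta>. (t - \<beta> / c) / 2" and ?y = "\<lambda>\<beta>. (t + \<beta> / c) / 2" and ?w = "tail_weight \<sigma> (Suc m)"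
  have "((\<lambda>\<beta>. bipoly ?w (Suc m) (?x \<beta>) (?y \<beta>)) has_field_derivative
      - 1 / (2 * c) * bipoly (?w \<circ> Suc) m (?x \<beta>) (?y \<beta>) + 1 / (2 * c) * bipoly ?w m (?x \<beta>) (?y \<beta>)) (at \<beta>)"
    using speed_pos by (intro bipoly_deriv) (auto intro!: derivative_eq_intros)
  moreover have "bipoly (weight_jump \<sigma> m) m x y = bipoly (?w \<circ> Suc) m x y - bipoly ?w m x y" for x y
    by (simp add: weight_jump_def[abs_def] bipoly_diff_weights o_def)
  then have "- 1 / (2 * c) * bipoly (?w \<circ> Suc) m x y + 1 / (2 * c) * bipoly ?w m x y
      = - 1 / (2 * c) * bipoly (weight_jump \<sigma> m) m x y" for x y
    by (simp add: right_diff_distrib diff_divide_distrib)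
  ultimately have "((\<lambda>\<beta>. bipoly ?w (Suc m) (?x \<beta>) (?y \<beta>)) has_field_derivative
      - 1 / (2 * c) * bipoly (weight_jump \<sigma> m) m (?x \<beta>) (?y \<beta>)) (at \<beta>)"
    by (simp only:)
  from DERIV_cmult[OF this, of "exp (- rate * t) * rate ^ n"] show ?thesis
    by (simp add: jump_tail_def[abs_def] tail_poly_def jump_density_def Suc)
qed

lemma jump_density_nonneg:
  assumes "0 < \<beta>" "\<beta> < c * t"
  shows "0 \<le> jump_density t \<sigma> n \<beta>"
proof -
  have "\<beta> / c < t" "0 < \<beta> / c"
    using assms speed_pos by (auto simp: pos_divide_less_eq mult.commute)
  then show ?thesis
    using speed_pos rate_pos unfolding jump_density_def
    by (auto split: nat.split intro!: mult_nonneg_nonneg divide_nonneg_nonneg bipoly_nonneg weight_jump_nonneg)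
qed

lemma emeasure_jump_law:
  assumes \<sigma>: "\<sigma> = 1 \<or> \<sigma> = - 1" and "0 < t" and B: "B \<in> sets borel" "B \<subseteq> {0<..<c * t}"
  shows "emeasure (jump_law t \<sigma> n) B = emeasure (density lborel (\<lambda>\<beta>. ennreal (jump_density t \<sigma> n \<beta>))) B"
proof (rule emeasure_eq_density_of_tail_deriv[OF _ _ _ _ _ _ _ B])
  have [measurable]: "running_max (telegraph V0 N) t \<in> borel_measurable M"
    "N t \<in> measurable M (count_space UNIV)"
    using \<open>0 < t\<close> by (auto intro: running_max_measurable)
  show "finite_measure (jump_law t \<sigma> n)"
    using prob_V0[OF \<sigma>] by (intro finite_measure_cond_law) auto
  show "sets (jump_law t \<sigma> n) = sets borel"
    by (simp add: cond_law_def)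
qed (auto intro: jump_law_tail[OF \<sigma> \<open>0 < t\<close>] jump_tail_deriv jump_density_nonneg)

text \<open>\<open>e\<close> enumerates the admissible numbers of jumps; its injectivity makes the
  events disjoint.\<close>

lemma density_series_parity:
  assumes \<sigma>: "\<sigma> = 1 \<or> \<sigma> = - 1" and "0 < t" and "inj e"
    and E: "\<And>\<omega>. E \<omega> \<longleftrightarrow> (\<exists>k. N t \<omega> = e k)"
    and sums: "\<And>\<beta>. 0 < \<beta> \<Longrightarrow> \<beta> < c * t \<Longrightarrow> (\<lambda>k. jump_density t \<sigma> (e k) \<beta>) sums g \<beta>"
  shows "density_series (cond_law M (running_max (telegraph V0 N) t) E (\<lambda>\<omega>. V0 \<omega> = \<sigma> * c))
    {0<..<c * t} (\<lambda>k. jump_density t \<sigma> (e k)) g"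
proof -
  have [measurable]: "running_max (telegraph V0 N) t \<in> borel_measurable M"
    "N t \<in> measurable M (count_space UNIV)"
    using \<open>0 < t\<close> by (auto intro: running_max_measurable)
  have [measurable]: "Measurable.pred M E"
    unfolding E by measurable
  interpret finite_measure "cond_law M (running_max (telegraph V0 N) t) E (\<lambda>\<omega>. V0 \<omega> = \<sigma> * c)"
    using prob_V0[OF \<sigma>] by (intro finite_measure_cond_law) auto
  show ?thesis
  proof
    fix B :: "real set" assume B: "B \<in> sets borel" "B \<subseteq> {0<..<c * t}"
    have "emeasure (cond_law M (running_max (telegraph V0 N) t) E (\<lambda>\<omega>. V0 \<omega> = \<sigma> * c)) B
        = (\<Sum>k. emeasure (jump_law t \<sigma> (e k)) B)"
      using \<open>inj e\<close> B by (intro emeasure_cond_law_Union E) (auto dest: injD)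
    then show "emeasure (cond_law M (running_max (telegraph V0 N) t) E (\<lambda>\<omega>. V0 \<omega> = \<sigma> * c)) B
        = (\<Sum>k. emeasure (density lborel (\<lambda>\<beta>. ennreal (jump_density t \<sigma> (e k) \<beta>))) B)"
      by (simp add: emeasure_jump_law[OF \<sigma> \<open>0 < t\<close> B])
  qed (auto simp: cond_law_def intro: jump_density_nonneg sums)
qed

section \<open>From monomials to Bessel functions\<close>

text \<open>The denominator is left as \<open>fact k * fact (k + 0)\<close> so that it matches the
  terms of \<open>bessel_series 0\<close>.\<close>

lemma jump_density_odd_pos:
  fixes t \<beta> :: real
  defines "x \<equiv> (t - \<beta> / c) / 2" and "y \<equiv> (t + \<beta> / c) / 2"
  shows "jump_density t 1 (2 * k + 1) \<beta>
    = exp (- rate * t) * rate / c * ((rate\<^sup>2 * (x * y)) ^ k / (fact k * fact (k + 0)))"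
proof -
  have "bipoly (weight_jump 1 (2 * k)) (2 * k) x y = 2 * (x ^ k / fact k) * (y ^ k / fact k)"
    by (simp add: weight_jump_odd_pos bipoly_single)
  moreover have "rate ^ (2 * k) = (rate\<^sup>2) ^ k"
    by (simp add: power_mult)
  ultimately show ?thesis
    unfolding jump_density_def x_def[symmetric] y_def[symmetric] using speed_pos
    by (simp add: power_mult_distrib)
qed

lemma jump_density_even_neg:
  fixes t \<beta> :: real
  defines "x \<equiv> (t - \<beta> / c) / 2" and "y \<equiv> (t + \<beta> / c) / 2"
  shows "jump_density t (- 1) (2 * Suc k) \<beta>
    = exp (- rate * t) * rate\<^sup>2 * x / c * ((rate\<^sup>2 * (x * y)) ^ k / (fact k * fact (k + 1)))"
proof -
  have "bipoly (weight_jump (- 1) (Suc (2 * k))) (Suc (2 * k)) x y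
      = 2 * (x ^ Suc k / fact (Suc k)) * (y ^ k / fact k)"
    by (simp add: weight_jump_even_neg bipoly_single)
  moreover have "rate ^ (2 * Suc k) = rate\<^sup>2 * (rate\<^sup>2) ^ k"
    by (simp only: power_mult power_Suc)
  moreover have "jump_density t (- 1) (2 * Suc k) \<beta> = exp (- rate * t) * rate ^ (2 * Suc k) / (2 * c)
      * bipoly (weight_jump (- 1) (Suc (2 * k))) (Suc (2 * k)) x y"
    by (simp add: jump_density_def x_def y_def)
  ultimately show ?thesis
    by (simp add: power_mult_distrib mult_ac del: fact_Suc mult_Suc_right)
qed

text \<open>The two monomials have different exponents. Multiplying by \<open>y\<close> makes
  \<open>(x * y) ^ k\<close> a common factor, and \<open>x + y = t\<close> combines the remaining
  terms.\<close>

lemma jump_density_odd_neg: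
  fixes t \<beta> :: real
  defines "x \<equiv> (t - \<beta> / c) / 2" and "y \<equiv> (t + \<beta> / c) / 2"
  assumes "y \<noteq> 0"
  shows "jump_density t (- 1) (2 * k + 1) \<beta>
    = exp (- rate * t) * rate / (2 * c * y) * (t * ((rate\<^sup>2 * (x * y)) ^ k / (fact k * fact (k + 0)))
        - x * ((rate\<^sup>2 * (x * y)) ^ k / (fact k * fact (k + 1))))"
proof -
  have t: "t = x + y"
    by (simp add: x_def y_def field_simps)
  have "y * bipoly (weight_jump (- 1) (2 * k)) (2 * k) x y
      = (x * y) ^ k * (t / (fact k * fact k) - x / (fact k * fact (k + 1)))"
  proof -
    have *: "bipoly (weight_jump (- 1) (2 * k)) (2 * k) x y = (x ^ k / fact k) * (y ^ k / fact k)
        + (if Suc k \<le> 2 * k then (x ^ Suc k / fact (Suc k)) * (y ^ (2 * k - Suc k) / fact (2 * k - Suc k)) else 0)"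
      by (simp add: weight_jump_odd_neg bipoly_add_weights bipoly_single)
    have "y * bipoly (weight_jump (- 1) (2 * k)) (2 * k) x y
        = (x * y) ^ k * (y / (fact k * fact k))
          + (x * y) ^ k * x * (1 / (fact k * fact k) - 1 / (fact k * fact (k + 1)))"
    \<comment> \<open>For \<open>k = 0\<close> the second monomial does not exist, and its would-be
      coefficient on the right is 0.\<close>
    proof (cases k)
      case 0
      then show ?thesis unfolding * by simp
    next
      case (Suc m)
      have "1 / (fact k * fact k) - 1 / (fact k * fact (k + 1)) = (1 / (fact (k + 1) * fact m) :: real)"
      proof -
        have "1 / (a * F * (a * F)) - 1 / (a * F * ((a + 1) * (a * F))) = 1 / ((a + 1) * (a * F) * F)"
          if "0 < a" "0 < F" for a F :: real
        proof -
          have "a + 1 \<noteq> 0" using that by simp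
          then show ?thesis using that by (simp add: divide_simps)
        qed
        from this[of "real (Suc m)" "fact m"] show ?thesis
          using Suc by (simp add: add_ac)
      qed
      then show ?thesis
        unfolding * using Suc by (simp add: power_mult_distrib algebra_simps)
    qed
    then show ?thesis
      by (simp add: t algebra_simps add_divide_distrib)
  qed
  then have "bipoly (weight_jump (- 1) (2 * k)) (2 * k) x y
      = (x * y) ^ k * (t / (fact k * fact k) - x / (fact k * fact (k + 1))) / y"
    using \<open>y \<noteq> 0\<close> by (simp add: field_simps)
  then show ?thesis
    unfolding jump_density_def x_def[symmetric] y_def[symmetric] using speed_pos
    by (simp add: power_mult_distrib power_mult[symmetric] field_simps)
qed

text \<open>The squared half-argument is \<open>rate^2\<close> times the product of the light-cone
  coordinates, so the sums of the monomials are Bessel series. The time is a separate variable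
  because it is also differentiated.\<close>

lemma bessel_argument:
  assumes "0 < \<beta>" "\<beta> < c * \<tau>"
  shows "(rate / c * sqrt (c\<^sup>2 * \<tau>\<^sup>2 - \<beta>\<^sup>2) / 2)\<^sup>2
    = rate\<^sup>2 * ((\<tau> - \<beta> / c) / 2 * ((\<tau> + \<beta> / c) / 2))"
proof -
  have "\<beta>\<^sup>2 \<le> (c * \<tau>)\<^sup>2"
    using assms by (intro power_mono) auto
  then have "(sqrt (c\<^sup>2 * \<tau>\<^sup>2 - \<beta>\<^sup>2))\<^sup>2 = c\<^sup>2 * \<tau>\<^sup>2 - \<beta>\<^sup>2"
    by (simp add: power_mult_distrib)
  then have "(rate / c * sqrt (c\<^sup>2 * \<tau>\<^sup>2 - \<beta>\<^sup>2) / 2)\<^sup>2 = rate\<^sup>2 * (c\<^sup>2 * \<tau>\<^sup>2 - \<beta>\<^sup>2) / (c\<^sup>2 * 4)"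
    by (simp add: power_mult_distrib power_divide)
  also have "\<dots> = rate\<^sup>2 * ((\<tau> - \<beta> / c) / 2 * ((\<tau> + \<beta> / c) / 2))"
    using speed_pos by (simp add: field_simps power2_eq_square)
  finally show ?thesis .
qed

lemma bessel_I_0_eq:
  assumes "0 < \<beta>" "\<beta> < c * \<tau>"
  shows "bessel_I 0 (rate / c * sqrt (c\<^sup>2 * \<tau>\<^sup>2 - \<beta>\<^sup>2))
    = bessel_series 0 (rate\<^sup>2 * ((\<tau> - \<beta> / c) / 2 * ((\<tau> + \<beta> / c) / 2)))"
  unfolding bessel_I_eq_series bessel_argument[OF assms] by simp

lemma bessel_I_1_eq:
  assumes "0 < \<beta>" "\<beta> < c * \<tau>"
  shows "bessel_I 1 (rate / c * sqrt (c\<^sup>2 * \<tau>\<^sup>2 - \<beta>\<^sup>2))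
    = rate * sqrt (c\<^sup>2 * \<tau>\<^sup>2 - \<beta>\<^sup>2) / (2 * c)
      * bessel_series 1 (rate\<^sup>2 * ((\<tau> - \<beta> / c) / 2 * ((\<tau> + \<beta> / c) / 2)))"
  unfolding bessel_I_eq_series bessel_argument[OF assms] by simp

definition even_density :: "real \<Rightarrow> real \<Rightarrow> real" where
  "even_density t \<beta> = exp (- rate * t) * (rate * (c * t - \<beta>)) / (c * sqrt (c\<^sup>2 * t\<^sup>2 - \<beta>\<^sup>2))
     * bessel_I 1 (rate / c * sqrt (c\<^sup>2 * t\<^sup>2 - \<beta>\<^sup>2))"

definition odd_density :: "real \<Rightarrow> real \<Rightarrow> real" where
  "odd_density t \<beta> = exp (- rate * t) / (c * t + \<beta>)
     * (rate * t * bessel_I 0 (rate / c * sqrt (c\<^sup>2 * t\<^sup>2 - \<beta>\<^sup>2))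
        - sqrt ((c * t - \<beta>) / (c * t + \<beta>)) * bessel_I 1 (rate / c * sqrt (c\<^sup>2 * t\<^sup>2 - \<beta>\<^sup>2)))"

definition odd_pos_density :: "real \<Rightarrow> real \<Rightarrow> real" where
  "odd_pos_density t \<beta> = exp (- rate * t) * rate / c * bessel_I 0 (rate / c * sqrt (c\<^sup>2 * t\<^sup>2 - \<beta>\<^sup>2))"

lemma even_density_eq:
  assumes "0 < \<beta>" "\<beta> < c * t"
  shows "even_density t \<beta> = exp (- rate * t) * rate\<^sup>2 * ((t - \<beta> / c) / 2) / c
    * bessel_series 1 (rate\<^sup>2 * ((t - \<beta> / c) / 2 * ((t + \<beta> / c) / 2)))"
proof -
  have "\<beta>\<^sup>2 < (c * t)\<^sup>2"
    using assms by (intro power_strict_mono) auto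
  then have "sqrt (c\<^sup>2 * t\<^sup>2 - \<beta>\<^sup>2) \<noteq> 0"
    by (simp add: power_mult_distrib)
  then show ?thesis
    unfolding even_density_def bessel_I_1_eq[OF assms] using speed_pos
    by (simp add: field_simps power2_eq_square)
qed

lemma odd_density_eq:
  assumes "0 < \<beta>" "\<beta> < c * t"
  defines "w \<equiv> rate\<^sup>2 * ((t - \<beta> / c) / 2 * ((t + \<beta> / c) / 2))"
  shows "odd_density t \<beta> = exp (- rate * t) * rate / (2 * c * ((t + \<beta> / c) / 2))
    * (t * bessel_series 0 w - (t - \<beta> / c) / 2 * bessel_series 1 w)"
proof -
  have pos: "0 < c * t + \<beta>" "0 < c * t - \<beta>"
    using assms by auto
  have "c\<^sup>2 * t\<^sup>2 - \<beta>\<^sup>2 = (c * t - \<beta>) * (c * t + \<beta>)"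
    by (simp add: power2_eq_square algebra_simps)
  then have sqrt: "sqrt ((c * t - \<beta>) / (c * t + \<beta>)) * sqrt (c\<^sup>2 * t\<^sup>2 - \<beta>\<^sup>2) = c * t - \<beta>"
    using pos by (simp add: real_sqrt_mult[symmetric])
  have "sqrt ((c * t - \<beta>) / (c * t + \<beta>)) * (rate * sqrt (c\<^sup>2 * t\<^sup>2 - \<beta>\<^sup>2) / (2 * c) * bessel_series 1 w)
      = rate / (2 * c) * bessel_series 1 w
        * (sqrt ((c * t - \<beta>) / (c * t + \<beta>)) * sqrt (c\<^sup>2 * t\<^sup>2 - \<beta>\<^sup>2))"
    by simp
  also have "\<dots> = rate * ((t - \<beta> / c) / 2 * bessel_series 1 w)"
    unfolding sqrt using speed_pos by (simp add: field_simps)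
  finally have "odd_density t \<beta> = exp (- rate * t) / (c * t + \<beta>)
      * (rate * t * bessel_series 0 w - rate * ((t - \<beta> / c) / 2 * bessel_series 1 w))"
    unfolding odd_density_def bessel_I_0_eq[OF assms(1,2)] bessel_I_1_eq[OF assms(1,2)] w_def[symmetric]
    by simp
  moreover have "2 * c * ((t + \<beta> / c) / 2) = c * t + \<beta>"
    using speed_pos by (simp add: field_simps)
  moreover have "e / D * (rate * t * u - rate * (x * v)) = e * rate / D * (t * u - x * v)" for e D u v x
    by (simp add: right_diff_distrib mult_ac)
  ultimately show ?thesis
    by (simp only:)
qed

lemma odd_density_relation:
  assumes "0 < \<beta>" "\<beta> < c * t"
  shows "odd_density t \<beta> = c * t / (c * t + \<beta>) * odd_pos_density t \<beta>
    - c / (rate * (c * t + \<beta>)) * even_density t \<beta>"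
proof -
  have D: "c * t + \<beta> \<noteq> 0" "2 * c * ((t + \<beta> / c) / 2) = c * t + \<beta>"
    using assms speed_pos by (auto simp: field_simps)
  have "e * rate / D * (t * u - x * v)
      = c * t / D * (e * rate / c * u) - c / (rate * D) * (e * rate\<^sup>2 * x / c * v)"
    if "D \<noteq> 0" for e D u v x
    using that speed_pos rate_pos by (simp add: field_simps power2_eq_square)
  from this[OF D(1)] show ?thesis
    unfolding odd_density_eq[OF assms] even_density_eq[OF assms] odd_pos_density_def bessel_I_0_eq[OF assms] D(2) .
qed

text \<open>The product of the light-cone coordinates has time derivative \<open>t / 2\<close>. The
  square root may be removed only for times beyond \<open>\<beta> / c\<close>, an open set
  containing \<open>t\<close>.\<close>

lemma bessel_I_0_time_deriv:
  assumes "0 < \<beta>" "\<beta> < c * t"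
  shows "((\<lambda>\<tau>. bessel_I 0 (rate / c * sqrt (c\<^sup>2 * \<tau>\<^sup>2 - \<beta>\<^sup>2))) has_field_derivative
    bessel_series 1 (rate\<^sup>2 * ((t - \<beta> / c) / 2 * ((t + \<beta> / c) / 2))) * (rate\<^sup>2 * t / 2)) (at t)"
proof (rule has_field_derivative_transform_within_open)
  show "((\<lambda>\<tau>. bessel_series 0 (rate\<^sup>2 * ((\<tau> - \<beta> / c) / 2 * ((\<tau> + \<beta> / c) / 2)))) has_field_derivative
    bessel_series 1 (rate\<^sup>2 * ((t - \<beta> / c) / 2 * ((t + \<beta> / c) / 2))) * (rate\<^sup>2 * t / 2)) (at t)"
    using speed_pos by (intro DERIV_chain2[OF bessel_series_deriv])
      (auto intro!: derivative_eq_intros simp: field_simps)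
  show "open {\<beta> / c<..}" "t \<in> {\<beta> / c<..}"
    using assms speed_pos by (auto simp: pos_divide_less_eq mult.commute)
  fix \<tau> assume "\<tau> \<in> {\<beta> / c<..}"
  then have "\<beta> < c * \<tau>"
    using speed_pos by (simp add: pos_divide_less_eq mult.commute)
  then show "bessel_series 0 (rate\<^sup>2 * ((\<tau> - \<beta> / c) / 2 * ((\<tau> + \<beta> / c) / 2)))
      = bessel_I 0 (rate / c * sqrt (c\<^sup>2 * \<tau>\<^sup>2 - \<beta>\<^sup>2))"
    by (rule bessel_I_0_eq[OF assms(1), symmetric])
qed

lemma even_density_time_deriv:
  assumes "0 < \<beta>" "\<beta> < c * t" "0 < t"
  shows "even_density t \<beta> = exp (- rate * t) / c * (1 - \<beta> / (c * t))
    * deriv (\<lambda>\<tau>. bessel_I 0 (rate / c * sqrt (c\<^sup>2 * \<tau>\<^sup>2 - \<beta>\<^sup>2))) t"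
  unfolding DERIV_imp_deriv[OF bessel_I_0_time_deriv[OF assms(1,2)]] even_density_eq[OF assms(1,2)]
  using speed_pos assms(3) by (simp add: field_simps power2_eq_square)

section \<open>The laws for the three combinations of parity and initial direction\<close>

lemma even_neg_law:
  assumes "0 < t"
  shows "density_series (cond_law M (running_max (telegraph V0 N) t) (\<lambda>\<omega>. even (N t \<omega>)) (\<lambda>\<omega>. V0 \<omega> = - c))
    {0<..<c * t} (\<lambda>k. jump_density t (- 1) (2 * k)) (even_density t)"
proof -
  have "(\<lambda>k. jump_density t (- 1) (2 * k) \<beta>) sums even_density t \<beta>" if "0 < \<beta>" "\<beta> < c * t" for \<beta>
  proof -
    have "(\<lambda>k. jump_density t (- 1) (2 * Suc k) \<beta>) sums even_density t \<beta>"
      unfolding jump_density_even_neg even_density_eq[OF that] by (intro sums_mult bessel_series_sums)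
    \<comment> \<open>The jump-free term contributes nothing, so the Bessel series starts with two
      jumps.\<close>
    moreover have "jump_density t (- 1) (2 * 0) \<beta> = 0"
      by (simp add: jump_density_def)
    ultimately show ?thesis
      using sums_Suc_iff[of "\<lambda>k. jump_density t (- 1) (2 * k) \<beta>" "even_density t \<beta>"] by simp
  qed
  moreover have "inj (\<lambda>k::nat. 2 * k)" "even n \<longleftrightarrow> (\<exists>k. n = 2 * k)" for n :: nat
    by (auto simp: inj_def elim: evenE)
  ultimately show ?thesis
    using density_series_parity[of "- 1" t "\<lambda>k. 2 * k" "\<lambda>\<omega>. even (N t \<omega>)" "even_density t"] assms
    by simp
qed

lemma odd_neg_law:
  assumes "0 < t"
  shows "density_series (cond_law M (running_max (telegraph V0 N) t) (\<lambda>\<omega>. odd (N t \<omega>)) (\<lambda>\<omega>. V0 \<omega> = - c))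
    {0<..<c * t} (\<lambda>k. jump_density t (- 1) (2 * k + 1)) (odd_density t)"
proof -
  have "(\<lambda>k. jump_density t (- 1) (2 * k + 1) \<beta>) sums odd_density t \<beta>" if "0 < \<beta>" "\<beta> < c * t" for \<beta>
  proof -
    have "(t + \<beta> / c) / 2 \<noteq> 0"
      using that speed_pos assms by (simp add: add_pos_pos less_imp_neq[symmetric])
    then show ?thesis
      unfolding jump_density_odd_neg[OF \<open>(t + \<beta> / c) / 2 \<noteq> 0\<close>] odd_density_eq[OF that]
      by (intro sums_mult sums_diff bessel_series_sums)
  qed
  moreover have "inj (\<lambda>k::nat. 2 * k + 1)" "odd n \<longleftrightarrow> (\<exists>k. n = 2 * k + 1)" for n :: nat
    by (auto simp: inj_def elim: oddE)
  ultimately show ?thesis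
    using density_series_parity[of "- 1" t "\<lambda>k. 2 * k + 1" "\<lambda>\<omega>. odd (N t \<omega>)" "odd_density t"] assms
    by simp
qed

lemma odd_pos_law:
  assumes "0 < t"
  shows "density_series (cond_law M (running_max (telegraph V0 N) t) (\<lambda>\<omega>. odd (N t \<omega>)) (\<lambda>\<omega>. V0 \<omega> = c))
    {0<..<c * t} (\<lambda>k. jump_density t 1 (2 * k + 1)) (odd_pos_density t)"
proof -
  have "(\<lambda>k. jump_density t 1 (2 * k + 1) \<beta>) sums odd_pos_density t \<beta>" if "0 < \<beta>" "\<beta> < c * t" for \<beta>
    unfolding jump_density_odd_pos odd_pos_density_def bessel_I_0_eq[OF that]
    by (intro sums_mult bessel_series_sums)
  moreover have "inj (\<lambda>k::nat. 2 * k + 1)" "odd n \<longleftrightarrow> (\<exists>k. n = 2 * k + 1)" for n :: nat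
    by (auto simp: inj_def elim: oddE)
  ultimately show ?thesis
    using density_series_parity[of 1 t "\<lambda>k. 2 * k + 1" "\<lambda>\<omega>. odd (N t \<omega>)" "odd_pos_density t"] assms
    by simp
qed

text \<open>The coefficients in the relation between the three laws depend on \<beta>; the relation
  is therefore stated by integrating them against the laws.\<close>

lemma measure_odd_neg_law:
  assumes "0 < t" and B: "B \<in> sets borel" "B \<subseteq> {0<..<c * t}"
  shows "measure (cond_law M (running_max (telegraph V0 N) t) (\<lambda>\<omega>. odd (N t \<omega>)) (\<lambda>\<omega>. V0 \<omega> = - c)) B
    = (LINT \<beta>:B|cond_law M (running_max (telegraph V0 N) t) (\<lambda>\<omega>. odd (N t \<omega>)) (\<lambda>\<omega>. V0 \<omega> = c).
         c * t / (c * t + \<beta>))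
      - (LINT \<beta>:B|cond_law M (running_max (telegraph V0 N) t) (\<lambda>\<omega>. even (N t \<omega>)) (\<lambda>\<omega>. V0 \<omega> = - c).
         c / (rate * (c * t + \<beta>)))"
proof -
  have pos: "0 < \<beta>" "\<beta> < c * t" if "\<beta> \<in> B" for \<beta>
    using that B by auto
  have ct: "0 < c * t"
    using speed_pos assms by simp
  \<comment> \<open>Bounded coefficients keep the products integrable, which allows the integral of
    the difference to be split.\<close>
  have bounds: "\<bar>c * t / (c * t + \<beta>)\<bar> \<le> 1" "\<bar>c / (rate * (c * t + \<beta>))\<bar> \<le> c / (rate * (c * t))"
    if "\<beta> \<in> B" for \<beta>
  proof -
    have "c / (rate * (c * t + \<beta>)) \<le> c / (rate * (c * t))"
      using pos[OF that] ct speed_pos rate_pos \<open>0 < t\<close>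
      by (intro divide_left_mono mult_left_mono mult_pos_pos) auto
    then show "\<bar>c * t / (c * t + \<beta>)\<bar> \<le> 1" "\<bar>c / (rate * (c * t + \<beta>))\<bar> \<le> c / (rate * (c * t))"
      using pos[OF that] ct speed_pos rate_pos \<open>0 < t\<close> by (auto simp: abs_of_pos)
  qed
  have "measure (cond_law M (running_max (telegraph V0 N) t) (\<lambda>\<omega>. odd (N t \<omega>)) (\<lambda>\<omega>. V0 \<omega> = - c)) B
      = (LBINT \<beta>:B. odd_density t \<beta>)"
    using density_series.has_density[OF odd_neg_law[OF \<open>0 < t\<close>]] B by (simp add: has_density_on_def)
  also have "\<dots> = (LBINT \<beta>:B. c * t / (c * t + \<beta>) * odd_pos_density t \<beta>
      - c / (rate * (c * t + \<beta>)) * even_density t \<beta>)"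
    using B pos by (intro set_lebesgue_integral_cong) (auto simp: odd_density_relation)
  also have "\<dots> = (LBINT \<beta>:B. c * t / (c * t + \<beta>) * odd_pos_density t \<beta>)
      - (LBINT \<beta>:B. c / (rate * (c * t + \<beta>)) * even_density t \<beta>)"
    by (intro set_integral_diff
        density_series.set_integrable_mult_density[OF odd_pos_law[OF \<open>0 < t\<close>] _ B bounds(1)]
        density_series.set_integrable_mult_density[OF even_neg_law[OF \<open>0 < t\<close>] _ B bounds(2)]) measurable
  also have "(LBINT \<beta>:B. c * t / (c * t + \<beta>) * odd_pos_density t \<beta>)
      = (LINT \<beta>:B|cond_law M (running_max (telegraph V0 N) t) (\<lambda>\<omega>. odd (N t \<omega>)) (\<lambda>\<omega>. V0 \<omega> = c).
         c * t / (c * t + \<beta>))"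
    by (rule density_series.set_integral_eq[OF odd_pos_law[OF \<open>0 < t\<close>] _ B, symmetric]) measurable
  also have "(LBINT \<beta>:B. c / (rate * (c * t + \<beta>)) * even_density t \<beta>)
      = (LINT \<beta>:B|cond_law M (running_max (telegraph V0 N) t) (\<lambda>\<omega>. even (N t \<omega>)) (\<lambda>\<omega>. V0 \<omega> = - c).
         c / (rate * (c * t + \<beta>)))"
    by (rule density_series.set_integral_eq[OF even_neg_law[OF \<open>0 < t\<close>] _ B, symmetric]) measurable
  finally show ?thesis .
qed

end

text \<open>Differentiability is asserted next to the formula with \<open>deriv\<close>, so that
  \<open>deriv\<close> denotes a genuine derivative there.\<close>

theorem mainTheorem10:
  fixes M :: "'a measure" and N :: "real \<Rightarrow> 'a \<Rightarrow> nat" and V0 :: "'a \<Rightarrow> real"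
    and c lam t :: real
  defines "Mx \<equiv> running_max (telegraph V0 N) t"
    and "\<xi> \<equiv> (\<lambda>\<tau> \<beta>. lam / c * sqrt (c\<^sup>2 * \<tau>\<^sup>2 - \<beta>\<^sup>2))"
  assumes "symmetric_telegraph M lam N c V0"
    and "t > 0"
  shows
    "has_density_on (cond_law M Mx (\<lambda>\<omega>. even (N t \<omega>)) (\<lambda>\<omega>. V0 \<omega> = - c)) {0<..<c * t}
       (\<lambda>\<beta>. exp (- lam * t) * (lam * (c * t - \<beta>)) / (c * sqrt (c\<^sup>2 * t\<^sup>2 - \<beta>\<^sup>2))
              * bessel_I 1 (\<xi> t \<beta>))
     \<and> (\<forall>\<beta>\<in>{0<..<c * t}.
          (\<lambda>\<tau>. bessel_I 0 (\<xi> \<tau> \<beta>)) differentiable (at t) \<and>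
          exp (- lam * t) * (lam * (c * t - \<beta>)) / (c * sqrt (c\<^sup>2 * t\<^sup>2 - \<beta>\<^sup>2))
              * bessel_I 1 (\<xi> t \<beta>)
            = exp (- lam * t) / c * (1 - \<beta> / (c * t)) * deriv (\<lambda>\<tau>. bessel_I 0 (\<xi> \<tau> \<beta>)) t)
     \<and> has_density_on (cond_law M Mx (\<lambda>\<omega>. odd (N t \<omega>)) (\<lambda>\<omega>. V0 \<omega> = - c)) {0<..<c * t}
       (\<lambda>\<beta>. exp (- lam * t) / (c * t + \<beta>)
              * (lam * t * bessel_I 0 (\<xi> t \<beta>)
                 - sqrt ((c * t - \<beta>) / (c * t + \<beta>)) * bessel_I 1 (\<xi> t \<beta>)))
     \<and> (\<forall>B\<in>sets borel. B \<subseteq> {0<..<c * t} \<longrightarrow>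
          measure (cond_law M Mx (\<lambda>\<omega>. odd (N t \<omega>)) (\<lambda>\<omega>. V0 \<omega> = - c)) B
            = (LINT \<beta>:B|cond_law M Mx (\<lambda>\<omega>. odd (N t \<omega>)) (\<lambda>\<omega>. V0 \<omega> = c).
                 c * t / (c * t + \<beta>))
              - (LINT \<beta>:B|cond_law M Mx (\<lambda>\<omega>. even (N t \<omega>)) (\<lambda>\<omega>. V0 \<omega> = - c).
                 c / (lam * (c * t + \<beta>))))"
proof -
  interpret symmetric_telegraph M lam N c V0 by fact
  have even: "even_density t = (\<lambda>\<beta>. exp (- lam * t) * (lam * (c * t - \<beta>)) / (c * sqrt (c\<^sup>2 * t\<^sup>2 - \<beta>\<^sup>2))
      * bessel_I 1 (\<xi> t \<beta>))"
    unfolding even_density_def \<xi>_def ..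
  have odd: "odd_density t = (\<lambda>\<beta>. exp (- lam * t) / (c * t + \<beta>)
      * (lam * t * bessel_I 0 (\<xi> t \<beta>) - sqrt ((c * t - \<beta>) / (c * t + \<beta>)) * bessel_I 1 (\<xi> t \<beta>)))"
    unfolding odd_density_def \<xi>_def ..
  show ?thesis
    unfolding even[symmetric] odd[symmetric] fun_cong[OF even, symmetric]
  proof (intro conjI ballI allI impI)
    show "has_density_on (cond_law M Mx (\<lambda>\<omega>. even (N t \<omega>)) (\<lambda>\<omega>. V0 \<omega> = - c)) {0<..<c * t} (even_density t)"
      unfolding Mx_def by (rule density_series.has_density[OF even_neg_law[OF \<open>t > 0\<close>]])
    show "has_density_on (cond_law M Mx (\<lambda>\<omega>. odd (N t \<omega>)) (\<lambda>\<omega>. V0 \<omega> = - c)) {0<..<c * t} (odd_density t)"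
      unfolding Mx_def by (rule density_series.has_density[OF odd_neg_law[OF \<open>t > 0\<close>]])
  next
    fix \<beta> assume \<beta>: "\<beta> \<in> {0<..<c * t}"
    then show "(\<lambda>\<tau>. bessel_I 0 (\<xi> \<tau> \<beta>)) differentiable (at t)"
      unfolding \<xi>_def
      by (intro differentiableI[OF has_field_derivative_imp_has_derivative[OF bessel_I_0_time_deriv]]) auto
    show "even_density t \<beta>
        = exp (- lam * t) / c * (1 - \<beta> / (c * t)) * deriv (\<lambda>\<tau>. bessel_I 0 (\<xi> \<tau> \<beta>)) t"
      unfolding \<xi>_def using \<beta> \<open>t > 0\<close> by (intro even_density_time_deriv) auto
  next
    fix B :: "real set" assume "B \<in> sets borel" "B \<subseteq> {0<..<c * t}"
    from measure_odd_neg_law[OF \<open>t > 0\<close> this]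
    show "measure (cond_law M Mx (\<lambda>\<omega>. odd (N t \<omega>)) (\<lambda>\<omega>. V0 \<omega> = - c)) B
        = (LINT \<beta>:B|cond_law M Mx (\<lambda>\<omega>. odd (N t \<omega>)) (\<lambda>\<omega>. V0 \<omega> = c). c * t / (c * t + \<beta>))
          - (LINT \<beta>:B|cond_law M Mx (\<lambda>\<omega>. even (N t \<omega>)) (\<lambda>\<omega>. V0 \<omega> = - c). c / (lam * (c * t + \<beta>)))"
      unfolding Mx_def .
  qed
qed

end
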